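(* Let $\rho:G\to\mathrm{GL}_d(\mathbb{C})$ be a representation (continuous homomorphism) of a connected solvable Lie group $G$. Then there exists $g\in\mathrm{GL}_d(\mathbb{C})$ such that $g\rho(G)g^{-1}$ is contained in the group of upper triangular matrices.
   Context: A (matrix) Lie group is a closed subgroup of $\mathrm{GL}_n(\mathbb{R})$ for some $n$. Its Lie algebra is $\mathcal{L}(G)=\{X\in\mathrm{M}_n(\mathbb{R}):\exp(tX)\in G\ \forall t\in\mathbb{R}\}$ with bracket $[X,Y]=XY-YX$. For a Lie algebra $\mathfrak{g}$ define $\mathfrak{g}^{(1)}=\langle[x,y]:x,y\in\mathfrak{g}\rangle$ and inductively $\mathfrak{g}^{(k+1)}=\langle[x,y]:x,y\in\mathfrak{g}^{(k)}\rangle$ (linear spans). A connected Lie group $G$ is called solvable if $\mathcal{L}(G)^{(k)}=0$ for some $k$. *)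

theory Defs
  imports "HOL-Analysis.Analysis" "HOL-Algebra.Group"
begin

definition GL :: "('a::field^'n^'n) monoid" where
  "GL = \<lparr>carrier = {A. invertible A}, mult = (**), one = mat 1\<rparr>"

lemma group_GL: "group (GL :: ('a::field^'n^'n) monoid)"
proof (rule groupI)
  fix x :: "'a^'n^'n" assume "x \<in> carrier GL"
  then obtain y where y: "x ** y = mat 1" "y ** x = mat 1"
    by (auto simp: GL_def invertible_def)
  then have "y \<in> carrier GL" by (auto simp: GL_def invertible_def)
  with y show "\<exists>y\<in>carrier GL. y \<otimes>\<^bsub>GL\<^esub> x = \<one>\<^bsub>GL\<^esub>" by (auto simp: GL_def)
next
  show "\<one>\<^bsub>GL\<^esub> \<in> carrier (GL :: ('a^'n^'n) monoid)"
    by (auto simp: GL_def invertible_def intro: exI[of _ "mat 1"])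
qed (auto simp: GL_def matrix_mul_assoc invertible_mult)

text \<open>Closedness is relative to the subspace topology of \<open>GL\<close>, not to all matrices.\<close>

definition matrix_Lie_group :: "(real^'n^'n) set \<Rightarrow> bool" where
  "matrix_Lie_group G \<longleftrightarrow> subgroup G GL \<and> closedin (top_of_set (carrier GL)) G"

text \<open>
  On \<open>real^'n^'n\<close> the operation \<open>*\<close> (and hence \<open>^\<close>) is
  componentwise, so powers are taken with respect to \<open>**\<close>.
\<close>

definition matrix_exp :: "real^'n^'n \<Rightarrow> real^'n^'n" where
  "matrix_exp A = (\<Sum>k. (1 / fact k) *\<^sub>R (((**) A ^^ k) (mat 1)))"

definition Lie_algebra :: "(real^'n^'n) set \<Rightarrow> (real^'n^'n) set" where
  "Lie_algebra G = {X. \<forall>t::real. matrix_exp (t *\<^sub>R X) \<in> G}"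

definition bracket :: "real^'n^'n \<Rightarrow> real^'n^'n \<Rightarrow> real^'n^'n" where
  "bracket X Y = X ** Y - Y ** X"

definition derived :: "(real^'n^'n) set \<Rightarrow> (real^'n^'n) set" where
  "derived L = span {bracket x y | x y. x \<in> L \<and> y \<in> L}"

definition derived_series :: "nat \<Rightarrow> (real^'n^'n) set \<Rightarrow> (real^'n^'n) set" where
  "derived_series k L = (derived ^^ k) L"

definition solvable_Lie_group :: "(real^'n^'n) set \<Rightarrow> bool" where
  "solvable_Lie_group G \<longleftrightarrow>
     matrix_Lie_group G \<and> connected G \<and> (\<exists>k\<ge>1. derived_series k (Lie_algebra G) = {0})"

definition representation ::
    "(real^'n^'n) set \<Rightarrow> (real^'n^'n \<Rightarrow> complex^'d^'d) \<Rightarrow> bool" where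
  "representation G \<rho> \<longleftrightarrow> \<rho> \<in> hom (GL\<lparr>carrier := G\<rparr>) GL \<and> continuous_on G \<rho>"

definition upper_triangular_group :: "(complex^'d::{finite,linorder}^'d::{finite,linorder}) set" where
  "upper_triangular_group = {A \<in> carrier GL. \<forall>i j. j < i \<longrightarrow> A $ i $ j = 0}"

end

theory Submission
  imports Defs "HOL-Computational_Algebra.Fundamental_Theorem_Algebra"
begin

text \<open>
  The differential of \<open>\<rho>\<close> appears here as the Lie algebra of the graph \<open>\<Gamma> =
  {(g, \<rho> g) | g \<in> G}\<close>, which is a connected, relatively closed subgroup of the units of the
  finite-dimensional algebra of pairs of a real and a complex matrix. This Lie algebra consists of the pairs
  \<open>(X, Y)\<close> with \<open>exp (t X) \<in> G\<close> and \<open>\<rho> (exp (t X)) = exp (t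
  Y)\<close> for all \<open>t\<close>. Such a \<open>Y\<close> is determined by \<open>X\<close>, because
  \<open>X = 0\<close> forces \<open>exp (t Y) = 1\<close> for all \<open>t\<close> and so \<open>Y =
  0\<close>; therefore the projection to the first component is injective, and solvability of the Lie
  algebra of \<open>G\<close> passes to the complex matrices \<open>Y\<close> that occur.

  Lie's theorem (\<open>solvable_common_eigenvector_mod\<close>) then gives a complete flag of
  \<open>\<complex>\<^sup>d\<close> that is invariant under all these \<open>Y\<close>. The elements of
  \<open>\<Gamma>\<close> whose second component preserves a space of the flag form a closed subgroup
  \<open>H\<close> with the same Lie algebra as \<open>\<Gamma>\<close>, and since \<open>\<Gamma>\<close>
  is connected, \<open>H = \<Gamma>\<close> (\<open>closed_subgroup_eq\<close>). A basis adapted to the flag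
  conjugates \<open>\<rho> G\<close> into triangular form.

  A connected closed group is determined by its Lie algebra for the following metric reason. If elements
  \<open>g\<^sub>k \<in> \<Gamma> - H\<close> tend to 1, choose \<open>h\<^sub>k \<in> H\<close> which
  nearly realises the distance of \<open>g\<^sub>k\<close> to \<open>H\<close>. A limit direction
  \<open>Z\<close> of \<open>g\<^sub>k - h\<^sub>k\<close> is tangent to \<open>\<Gamma>\<close>
  (\<open>tangent_in_Lie\<close>), hence to \<open>H\<close>, and moving \<open>h\<^sub>k\<close> along
  \<open>exp (t Z)\<close> inside \<open>H\<close> brings it much closer to \<open>g\<^sub>k\<close>, a
  contradiction.

  The heart of Lie's theorem, that a weight vanishes on brackets \<open>[y, x]\<close>
  (\<open>weight_vanishes_on_bracket\<close>), has a topological proof. Conjugating \<open>y\<close> with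
  \<open>exp (t x)\<close> changes its weight continuously in \<open>t\<close>, while the weight stays among
  the finitely many eigenvalues of \<open>y\<close>. It is therefore constant, and its derivative, the
  weight of the bracket, is 0.
\<close>

section \<open>The Banach algebra of endomorphisms of a Euclidean space\<close>

text \<open>
  The function \<open>exp\<close> is defined on types of class \<open>real_normed_algebra_1\<close>. The
  type \<open>'a \<Rightarrow>\<^sub>L 'a\<close> is an instance of the two-argument constructor
  \<open>blinfun\<close> and cannot carry a multiplication by itself, hence this copy. Matrices cannot play
  its part: multiplication on the type of vectors of vectors is componentwise, and in dimension
  greater than 1 the Euclidean norm of the identity matrix is not 1.
\<close>

typedef (overloaded) 'a endo = "UNIV :: ('a::euclidean_space \<Rightarrow>\<^sub>L 'a) set"
  morphisms Rep_endo Abs_endo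
  by auto

setup_lifting type_definition_endo

instantiation endo :: (euclidean_space) real_normed_vector
begin
lift_definition zero_endo :: "'a endo" is 0 .
lift_definition plus_endo :: "'a endo \<Rightarrow> 'a endo \<Rightarrow> 'a endo" is "(+)" .
lift_definition minus_endo :: "'a endo \<Rightarrow> 'a endo \<Rightarrow> 'a endo" is "(-)" .
lift_definition uminus_endo :: "'a endo \<Rightarrow> 'a endo" is uminus .
lift_definition scaleR_endo :: "real \<Rightarrow> 'a endo \<Rightarrow> 'a endo" is scaleR .
lift_definition norm_endo :: "'a endo \<Rightarrow> real" is norm .
definition dist_endo :: "'a endo \<Rightarrow> 'a endo \<Rightarrow> real"
  where "dist_endo x y = norm (x - y)"
definition sgn_endo :: "'a endo \<Rightarrow> 'a endo"
  where "sgn_endo x = inverse (norm x) *\<^sub>R x"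
definition uniformity_endo :: "('a endo \<times> 'a endo) filter"
  where "uniformity_endo = (INF e\<in>{0 <..}. principal {(x, y). dist x y < e})"
definition open_endo :: "'a endo set \<Rightarrow> bool"
  where "open_endo U \<longleftrightarrow> (\<forall>x\<in>U. eventually (\<lambda>(x', y). x' = x \<longrightarrow> y \<in> U) uniformity)"
instance
  by standard
    (transfer; auto simp: dist_endo_def sgn_endo_def uniformity_endo_def open_endo_def
      scaleR_add_right scaleR_add_left norm_triangle_ineq; fail |
     simp add: dist_endo_def sgn_endo_def uniformity_endo_def open_endo_def; fail)+
end

instantiation endo :: (euclidean_space) real_normed_algebra_1
begin
lift_definition times_endo :: "'a endo \<Rightarrow> 'a endo \<Rightarrow> 'a endo" is "(o\<^sub>L)" .
lift_definition one_endo :: "'a endo" is id_blinfun .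
instance
proof
  show "(0 :: 'a endo) \<noteq> 1"
    by transfer (metis norm_blinfun_id norm_zero zero_neq_one)
qed (transfer; auto intro!: blinfun_eqI simp: blinfun.bilinear_simps norm_blinfun_compose; fail)+
end

instance endo :: (euclidean_space) banach
proof
  fix X :: "nat \<Rightarrow> 'a endo"
  assume "Cauchy X"
  then have "Cauchy (\<lambda>n. Rep_endo (X n))"
    unfolding Cauchy_def by (simp add: dist_norm norm_endo.rep_eq minus_endo.rep_eq)
  then obtain L where "(\<lambda>n. Rep_endo (X n)) \<longlonglongrightarrow> L"
    by (auto simp: Cauchy_convergent_iff convergent_def)
  then have "X \<longlonglongrightarrow> Abs_endo L"
    by (simp add: lim_sequentially dist_norm norm_endo.rep_eq minus_endo.rep_eq Abs_endo_inverse)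
  then show "convergent X"
    by (auto simp: convergent_def)
qed

lift_definition endo_apply :: "'a::euclidean_space endo \<Rightarrow> 'a \<Rightarrow> 'a" is blinfun_apply .

lemma bounded_bilinear_endo_apply: "bounded_bilinear endo_apply"
  by (rule bounded_bilinear.intro; (transfer; simp add: blinfun.bilinear_simps)?)
    (rule exI[of _ 1], simp add: endo_apply.rep_eq norm_endo.rep_eq, metis norm_blinfun)

interpretation endo_apply: bounded_bilinear endo_apply
  by (rule bounded_bilinear_endo_apply)

lemma endo_apply_mult [simp]: "endo_apply (S * T) v = endo_apply S (endo_apply T v)"
  by transfer simp

lemma endo_apply_one [simp]: "endo_apply 1 v = v"
  by transfer simp

lemma endo_eqI: "(\<And>v. endo_apply S v = endo_apply T v) \<Longrightarrow> S = T"
  by transfer (rule blinfun_eqI)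

text \<open>Of interest only for linear \<open>f\<close>; otherwise the value is arbitrary.\<close>

definition endo_of :: "('a::euclidean_space \<Rightarrow> 'a) \<Rightarrow> 'a endo"
  where "endo_of f = Abs_endo (Blinfun f)"

lemma endo_apply_endo_of: "linear f \<Longrightarrow> endo_apply (endo_of f) v = f v"
  by (simp add: endo_of_def endo_apply.rep_eq Abs_endo_inverse bounded_linear_Blinfun_apply
      linear_conv_bounded_linear)

lemma endo_apply_power: "endo_apply (T ^ k) v = (endo_apply T ^^ k) v"
  by (induction k) auto

lemma endo_apply_exp_sums:
  "(\<lambda>k. (1 / fact k) *\<^sub>R (endo_apply T ^^ k) v) sums endo_apply (exp T) v"
  using bounded_linear.sums[OF endo_apply.bounded_linear_left exp_converges[of T], of v]
  by (simp add: endo_apply.scaleR_left divide_inverse endo_apply_power)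

lemma funpow_closed: "v \<in> h \<Longrightarrow> (\<And>w. w \<in> h \<Longrightarrow> f w \<in> h) \<Longrightarrow> (f ^^ k) v \<in> h"
  by (induction k) auto

lemma endo_exp_invariant:
  assumes "subspace h" "v \<in> h" "\<And>w. w \<in> h \<Longrightarrow> endo_apply T w \<in> h"
  shows "endo_apply (exp T) v \<in> h"
proof (rule closed_sequentially[OF closed_subspace[OF assms(1)]])
  show "(\<lambda>n. \<Sum>k<n. (1 / fact k) *\<^sub>R (endo_apply T ^^ k) v) \<longlonglongrightarrow> endo_apply (exp T) v"
    using endo_apply_exp_sums[of T v] unfolding sums_def .
  show "(\<Sum>k<n. (1 / fact k) *\<^sub>R (endo_apply T ^^ k) v) \<in> h" for n
    using assms by (intro subspace_sum subspace_scale funpow_closed)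
qed

section \<open>The exponential in a finite-dimensional algebra\<close>

text \<open>
  The carrier is a Euclidean space, so that subspaces are closed and spheres are compact; in exchange the
  norm is not assumed to be submultiplicative. The left regular representation \<open>Lmult\<close> embeds
  the algebra into its endomorphisms and carries the facts about \<open>exp\<close> there back to
  \<open>Exp\<close>.
\<close>

locale fin_dim_algebra =
  fixes mult :: "'a::euclidean_space \<Rightarrow> 'a \<Rightarrow> 'a" (infixl "\<odot>" 70)
    and unit :: 'a
  assumes bilinear_mult: "bilinear (\<odot>)"
    and mult_assoc: "x \<odot> y \<odot> z = x \<odot> (y \<odot> z)"
    and unit_left [simp]: "unit \<odot> x = x"
    and unit_right [simp]: "x \<odot> unit = x"
begin

lemma bounded_bilinear_mult: "bounded_bilinear (\<odot>)"
  using bilinear_mult by (simp add: bilinear_conv_bounded_bilinear)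

sublocale mult: bounded_bilinear "(\<odot>)"
  by (rule bounded_bilinear_mult)

definition Lmult :: "'a \<Rightarrow> 'a endo" where "Lmult x = endo_of (\<lambda>y. x \<odot> y)"

definition Rmult :: "'a \<Rightarrow> 'a endo" where "Rmult x = endo_of (\<lambda>y. y \<odot> x)"

definition Exp :: "'a \<Rightarrow> 'a" where "Exp x = (\<Sum>k. (1 / fact k) *\<^sub>R (((\<odot>) x ^^ k) unit))"

lemma apply_Lmult [simp]: "endo_apply (Lmult x) y = x \<odot> y"
  unfolding Lmult_def
  by (rule endo_apply_endo_of) (rule bounded_linear.linear, rule mult.bounded_linear_right)

lemma apply_Rmult [simp]: "endo_apply (Rmult x) y = y \<odot> x"
  unfolding Rmult_def
  by (rule endo_apply_endo_of) (rule bounded_linear.linear, rule mult.bounded_linear_left)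

lemma Lmult_mult: "Lmult (x \<odot> y) = Lmult x * Lmult y"
  by (rule endo_eqI) (simp add: mult_assoc)

lemma Lmult_unit: "Lmult unit = 1"
  by (rule endo_eqI) simp

lemma linear_Lmult: "linear Lmult"
  by (rule linearI; rule endo_eqI)
    (simp_all add: endo_apply.add_left endo_apply.scaleR_left mult.add_left mult.scaleR_left)

lemma bounded_linear_Lmult: "bounded_linear Lmult"
  using linear_Lmult by (simp add: linear_conv_bounded_linear)

interpretation Lmult: bounded_linear Lmult
  by (rule bounded_linear_Lmult)

lemma Exp_eq_exp: "Exp x = endo_apply (exp (Lmult x)) unit"
proof -
  have "endo_apply (Lmult x) = (\<odot>) x"
    by (rule ext) simp
  then show ?thesis
    unfolding Exp_def using endo_apply_exp_sums[of "Lmult x" unit] by (simp add: sums_iff)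
qed

lemma Exp_sums: "(\<lambda>k. (1 / fact k) *\<^sub>R (((\<odot>) x ^^ k) unit)) sums Exp x"
proof -
  have "endo_apply (Lmult x) = (\<odot>) x"
    by (rule ext) simp
  then show ?thesis
    using endo_apply_exp_sums[of "Lmult x" unit] by (simp add: Exp_eq_exp)
qed

lemma funpow_mult_right: "((\<odot>) x ^^ k) y = ((\<odot>) x ^^ k) unit \<odot> y"
  by (induction k) (simp_all add: mult_assoc)

lemma exp_Lmult: "exp (Lmult x) = Lmult (Exp x)"
proof (rule endo_eqI)
  fix y
  have *: "endo_apply (Lmult x) = (\<odot>) x"
    by (rule ext) simp
  have "(\<lambda>k. (1 / fact k) *\<^sub>R (((\<odot>) x ^^ k) y)) sums (Exp x \<odot> y)"
    using bounded_linear.sums[OF mult.bounded_linear_left Exp_sums[of x], of y]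
    by (subst funpow_mult_right) (simp add: mult.scaleR_left)
  moreover have "(\<lambda>k. (1 / fact k) *\<^sub>R (((\<odot>) x ^^ k) y)) sums endo_apply (exp (Lmult x)) y"
    using endo_apply_exp_sums[of "Lmult x" y] by (simp add: *)
  ultimately show "endo_apply (exp (Lmult x)) y = endo_apply (Lmult (Exp x)) y"
    using sums_unique2 by fastforce
qed

lemma funpow_mult_commute: "((\<odot>) x ^^ k) unit \<odot> x = x \<odot> ((\<odot>) x ^^ k) unit"
  by (induction k) (simp_all add: mult_assoc)

lemma exp_Rmult: "exp (Rmult x) = Rmult (Exp x)"
proof (rule endo_eqI)
  fix y
  have pow: "(endo_apply (Rmult x) ^^ k) y = y \<odot> ((\<odot>) x ^^ k) unit" for k
    by (induction k) (simp_all add: mult_assoc funpow_mult_commute)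
  have "(\<lambda>k. (1 / fact k) *\<^sub>R (y \<odot> ((\<odot>) x ^^ k) unit)) sums (y \<odot> Exp x)"
    using bounded_linear.sums[OF mult.bounded_linear_right Exp_sums[of x], of y]
    by (simp add: mult.scaleR_right)
  moreover have "(\<lambda>k. (1 / fact k) *\<^sub>R (y \<odot> ((\<odot>) x ^^ k) unit)) sums endo_apply (exp (Rmult x)) y"
    using endo_apply_exp_sums[of "Rmult x" y] by (simp add: pow)
  ultimately show "endo_apply (exp (Rmult x)) y = endo_apply (Rmult (Exp x)) y"
    using sums_unique2 by fastforce
qed

lemma Exp_zero [simp]: "Exp 0 = unit"
  by (simp add: Exp_eq_exp Lmult.zero)

lemma Exp_add: "Exp ((s + t) *\<^sub>R x) = Exp (s *\<^sub>R x) \<odot> Exp (t *\<^sub>R x)"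
proof -
  have "exp (Lmult ((s + t) *\<^sub>R x)) = exp (Lmult (s *\<^sub>R x)) * exp (Lmult (t *\<^sub>R x))"
    unfolding scaleR_add_left Lmult.add by (rule exp_add_commuting) (simp add: Lmult.scaleR)
  then have "endo_apply (Lmult (Exp ((s + t) *\<^sub>R x))) unit
    = endo_apply (Lmult (Exp (s *\<^sub>R x) \<odot> Exp (t *\<^sub>R x))) unit"
    by (simp only: exp_Lmult Lmult_mult)
  then show ?thesis by simp
qed

lemma Exp_inverse: "Exp (t *\<^sub>R x) \<odot> Exp (- t *\<^sub>R x) = unit"
  "Exp (- t *\<^sub>R x) \<odot> Exp (t *\<^sub>R x) = unit"
  using Exp_add[of t "-t" x] Exp_add[of "-t" t x] by simp_all

lemma Exp_has_vector_derivative: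
  "((\<lambda>t. Exp (t *\<^sub>R x)) has_vector_derivative (Exp (t *\<^sub>R x) \<odot> x)) (at t)"
proof -
  have "((\<lambda>t. exp (t *\<^sub>R Lmult x)) has_vector_derivative exp (t *\<^sub>R Lmult x) * Lmult x) (at t)"
    by (rule exp_scaleR_has_vector_derivative_right)
  then have "((\<lambda>t. endo_apply (exp (t *\<^sub>R Lmult x)) unit) has_vector_derivative
      endo_apply (exp (t *\<^sub>R Lmult x) * Lmult x) unit) (at t)"
    by (rule bounded_linear.has_vector_derivative[OF endo_apply.bounded_linear_left])
  moreover have "exp (s *\<^sub>R Lmult x) = Lmult (Exp (s *\<^sub>R x))" for s
    by (simp add: exp_Lmult flip: Lmult.scaleR)
  ultimately show ?thesis by simp
qed

lemma eq_0_if_Exp_trivial: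
  assumes "\<And>t. Exp (t *\<^sub>R x) = unit"
  shows "x = 0"
proof -
  have "((\<lambda>t. unit) has_vector_derivative x) (at 0)"
    using Exp_has_vector_derivative[of x 0] assms by simp
  then show ?thesis
    using vector_derivative_unique_at has_vector_derivative_const by blast
qed

lemma continuous_Exp_scaleR: "continuous_on UNIV (\<lambda>t. Exp (t *\<^sub>R x))"
  by (intro continuous_at_imp_continuous_on ballI has_vector_derivative_continuous)
    (rule Exp_has_vector_derivative)

text \<open>The bracket is the infinitesimal form of conjugation.\<close>

lemma Exp_conj_has_vector_derivative:
  "((\<lambda>t. Exp (- t *\<^sub>R x) \<odot> y \<odot> Exp (t *\<^sub>R x)) has_vector_derivative (y \<odot> x - x \<odot> y)) (at 0)"
proof -
  have 1: "((\<lambda>t. Exp (- t *\<^sub>R x)) has_vector_derivative - x) (at 0)"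
    using Exp_has_vector_derivative[of "-x" 0] by simp
  have 2: "((\<lambda>t. Exp (t *\<^sub>R x)) has_vector_derivative x) (at 0)"
    using Exp_has_vector_derivative[of x 0] by simp
  have 3: "((\<lambda>t. Exp (- t *\<^sub>R x) \<odot> y) has_vector_derivative - x \<odot> y) (at 0)"
    by (rule bounded_linear.has_vector_derivative[OF mult.bounded_linear_left 1])
  show ?thesis
    using mult.has_vector_derivative[OF 3 2] by (simp add: mult.minus_left)
qed

lemma Exp_conj:
  assumes "g \<odot> g' = unit" "g' \<odot> g = unit"
  shows "Exp (g \<odot> x \<odot> g') = g \<odot> Exp x \<odot> g'"
proof -
  have pow: "((\<odot>) (g \<odot> x \<odot> g') ^^ k) unit = g \<odot> ((\<odot>) x ^^ k) unit \<odot> g'" for k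
  proof (induction k)
    case (Suc k)
    have "(g \<odot> x \<odot> g') \<odot> (g \<odot> ((\<odot>) x ^^ k) unit \<odot> g') = g \<odot> x \<odot> (g' \<odot> g) \<odot> ((\<odot>) x ^^ k) unit \<odot> g'"
      by (simp only: mult_assoc)
    then show ?case
      using Suc assms by (simp add: mult_assoc)
  qed (simp add: assms)
  have "bounded_linear (\<lambda>y. g \<odot> y \<odot> g')"
    by (rule bounded_linear_compose[OF mult.bounded_linear_left mult.bounded_linear_right])
  from bounded_linear.sums[OF this Exp_sums[of x]]
  have "(\<lambda>k. (1 / fact k) *\<^sub>R (((\<odot>) (g \<odot> x \<odot> g') ^^ k) unit)) sums (g \<odot> Exp x \<odot> g')"
    by (simp add: pow mult.scaleR_left mult.scaleR_right)
  with Exp_sums show ?thesis by (rule sums_unique2)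
qed

text \<open>
  Conjugation by \<open>Exp x\<close> is the exponential of the inner derivation: right and left
  multiplication by \<open>x\<close> commute as endomorphisms, so the exponential of their difference is a
  product. A subspace invariant under the derivation is closed and contains the sum of the exponential
  series.
\<close>

lemma Exp_conj_invariant:
  assumes h: "subspace h" and y: "y \<in> h" and inv: "\<And>y. y \<in> h \<Longrightarrow> y \<odot> x - x \<odot> y \<in> h"
  shows "Exp (- t *\<^sub>R x) \<odot> y \<odot> Exp (t *\<^sub>R x) \<in> h"
proof -
  let ?T = "Rmult (t *\<^sub>R x) + Lmult (- t *\<^sub>R x)"
  have "endo_apply ?T w = t *\<^sub>R (w \<odot> x - x \<odot> w)" for w
    by (simp add: endo_apply.add_left mult.scaleR_left mult.scaleR_right mult.minus_left
        scaleR_diff_right)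
  then have "endo_apply (exp ?T) y \<in> h"
    using h y inv by (intro endo_exp_invariant) (auto intro: subspace_scale)
  moreover have "exp ?T = exp (Rmult (t *\<^sub>R x)) * exp (Lmult (- t *\<^sub>R x))"
    by (rule exp_add_commuting) (rule endo_eqI, simp add: mult_assoc)
  ultimately show ?thesis
    by (simp add: exp_Lmult exp_Rmult)
qed

end

section \<open>Closed groups and their Lie algebras\<close>

lemma difference_quotient_seq:
  assumes f: "(f has_vector_derivative D) (at 0)"
    and e: "\<epsilon> \<longlonglongrightarrow> 0" "\<And>k. \<epsilon> k \<noteq> (0::real)"
  shows "(\<lambda>k. (f (\<epsilon> k) - f 0) /\<^sub>R \<epsilon> k) \<longlonglongrightarrow> D"
proof -
  have "((\<lambda>y. norm (f y - f 0 - (y - 0) *\<^sub>R D) / norm (y - 0)) \<longlongrightarrow> 0) (at 0)"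
    using f unfolding has_vector_derivative_def has_derivative_iff_norm by simp
  moreover have "filterlim \<epsilon> (at 0) sequentially"
    using e by (simp add: filterlim_at)
  ultimately have "(\<lambda>k. norm (f (\<epsilon> k) - f 0 - (\<epsilon> k - 0) *\<^sub>R D) / norm (\<epsilon> k - 0)) \<longlonglongrightarrow> 0"
    by (rule filterlim_compose)
  moreover have "norm (f (\<epsilon> k) - f 0 - (\<epsilon> k - 0) *\<^sub>R D) / norm (\<epsilon> k - 0)
      = norm ((f (\<epsilon> k) - f 0) /\<^sub>R \<epsilon> k - D)" for k
  proof -
    have "(f (\<epsilon> k) - f 0) /\<^sub>R \<epsilon> k - D = (f (\<epsilon> k) - f 0 - \<epsilon> k *\<^sub>R D) /\<^sub>R \<epsilon> k"
      using e(2)[of k] by (simp add: scaleR_diff_right)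
    then show ?thesis by (simp add: divide_inverse mult.commute)
  qed
  ultimately have "(\<lambda>k. (f (\<epsilon> k) - f 0) /\<^sub>R \<epsilon> k - D) \<longlonglongrightarrow> 0"
    by (simp add: tendsto_norm_zero_iff)
  then show ?thesis by (simp add: LIM_zero_iff)
qed

lemma norm_power_diff_le:
  fixes u w :: "'a::real_normed_algebra_1"
  assumes "norm u \<le> B" "norm w \<le> B" "1 \<le> B"
  shows "norm (u ^ m - w ^ m) \<le> m * B ^ m * norm (u - w)"
proof (induction m)
  case (Suc m)
  have wm: "norm (w ^ m) \<le> B ^ m"
    by (meson assms(2) norm_ge_zero norm_power_ineq order_trans power_mono)
  have "norm (u ^ Suc m - w ^ Suc m) = norm (u * (u ^ m - w ^ m) + (u - w) * w ^ m)"
    by (simp add: algebra_simps)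
  also have "\<dots> \<le> norm u * norm (u ^ m - w ^ m) + norm (u - w) * norm (w ^ m)"
    by (meson norm_mult_ineq norm_triangle_mono)
  also have "\<dots> \<le> B * (m * B ^ m * norm (u - w)) + norm (u - w) * B ^ m"
    using assms Suc.IH wm by (intro add_mono mult_mono) auto
  also have "norm (u - w) * B ^ m \<le> norm (u - w) * B ^ Suc m"
    using assms by (intro mult_left_mono) (auto intro: mult_right_mono[of 1 B, simplified])
  finally show ?case by (simp add: algebra_simps)
qed simp

lemma exp_scaleR_power:
  fixes Z :: "'a::{real_normed_algebra_1,banach}"
  shows "exp (s *\<^sub>R Z) ^ m = exp ((m * s) *\<^sub>R Z)"
proof (induction m)
  case (Suc m)
  have "exp ((s + m * s) *\<^sub>R Z) = exp (s *\<^sub>R Z) * exp ((m * s) *\<^sub>R Z)"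
    unfolding scaleR_add_left by (rule exp_add_commuting) simp
  then show ?case
    using Suc by (simp add: algebra_simps)
qed simp

text \<open>
  A quantitative form of \<open>(1 + z / m) ^ m \<longlonglongrightarrow> exp z\<close>. It produces
  one-parameter groups from convergent directions, and thereby also the sums in a Lie algebra. Comparing
  \<open>u k\<close> with \<open>exp (\<epsilon> k *\<^sub>R Z)\<close>, the difference is
  \<open>o(\<epsilon> k)\<close>, and raising to a power of order \<open>1 / \<epsilon> k\<close> multiplies
  it by at most a constant times \<open>1 / \<epsilon> k\<close>.
\<close>

lemma power_tendsto_exp:
  fixes u :: "nat \<Rightarrow> 'a::{real_normed_algebra_1,banach}"
  assumes e: "\<epsilon> \<longlonglongrightarrow> 0" "\<And>k. \<epsilon> k > (0::real)"
    and Z: "(\<lambda>k. (u k - 1) /\<^sub>R \<epsilon> k) \<longlonglongrightarrow> Z"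
    and m: "(\<lambda>k. real (m k) * \<epsilon> k) \<longlonglongrightarrow> t"
  shows "(\<lambda>k. u k ^ m k) \<longlonglongrightarrow> exp (t *\<^sub>R Z)"
proof -
  define w where "w k = exp (\<epsilon> k *\<^sub>R Z)" for k
  have "(\<lambda>k. (w k - 1) /\<^sub>R \<epsilon> k) \<longlonglongrightarrow> Z"
    using difference_quotient_seq[OF exp_scaleR_has_vector_derivative_right[of Z 0 UNIV, simplified] e(1)]
      e(2) by (simp add: w_def less_imp_neq[symmetric])
  then have "(\<lambda>k. (u k - 1) /\<^sub>R \<epsilon> k - (w k - 1) /\<^sub>R \<epsilon> k) \<longlonglongrightarrow> 0"
    using tendsto_diff[OF Z] by fastforce
  then have "(\<lambda>k. (u k - w k) /\<^sub>R \<epsilon> k) \<longlonglongrightarrow> 0"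
    by (simp flip: scaleR_diff_right)
  then have r: "(\<lambda>k. norm ((u k - w k) /\<^sub>R \<epsilon> k)) \<longlonglongrightarrow> 0"
    by (rule tendsto_norm_zero)
  \<comment> \<open>A common bound \<open>exp (\<epsilon> k * M)\<close> for the norms, whose \<open>m k\<close>-th power converges.\<close>
  obtain M0 where M0: "norm ((u k - 1) /\<^sub>R \<epsilon> k) \<le> M0" for k
    using convergent_imp_Bseq[OF convergentI[OF Z]] unfolding Bseq_def by blast
  define M where "M = max M0 (norm Z)"
  have "M \<ge> 0" unfolding M_def by (simp add: le_max_iff_disj)
  have u: "norm (u k) \<le> exp (\<epsilon> k * M)" for k
  proof -
    have "norm (u k - 1) = \<epsilon> k * norm ((u k - 1) /\<^sub>R \<epsilon> k)"
      using e(2)[of k] by simp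
    also have "\<dots> \<le> \<epsilon> k * M"
      using M0[of k] e(2)[of k] unfolding M_def by (intro mult_left_mono) auto
    finally have "norm (u k) \<le> 1 + \<epsilon> k * M"
      using norm_triangle_ineq[of "u k - 1" 1] by simp
    then show ?thesis
      using exp_ge_add_one_self order_trans by blast
  qed
  have w: "norm (w k) \<le> exp (\<epsilon> k * M)" for k
    using norm_exp[of "\<epsilon> k *\<^sub>R Z"] e(2)[of k] unfolding w_def M_def
    by (smt (verit) exp_le_cancel_iff max.cobounded2 mult_left_mono norm_scaleR)
  have bound: "norm (u k ^ m k - w k ^ m k)
      \<le> (m k * \<epsilon> k) * exp (m k * \<epsilon> k * M) * norm ((u k - w k) /\<^sub>R \<epsilon> k)" for k
  proof -
    have "norm (u k ^ m k - w k ^ m k) \<le> m k * exp (\<epsilon> k * M) ^ m k * norm (u k - w k)"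
      using e(2)[of k] \<open>M \<ge> 0\<close> by (intro norm_power_diff_le u w) simp
    also have "exp (\<epsilon> k * M) ^ m k = exp (m k * \<epsilon> k * M)"
      by (simp add: exp_of_nat_mult[symmetric] mult.assoc)
    also have "norm (u k - w k) = \<epsilon> k * norm ((u k - w k) /\<^sub>R \<epsilon> k)"
      using e(2)[of k] by simp
    finally show ?thesis by (simp add: mult_ac)
  qed
  have "(\<lambda>k. (m k * \<epsilon> k) * exp (m k * \<epsilon> k * M) * norm ((u k - w k) /\<^sub>R \<epsilon> k))
      \<longlonglongrightarrow> t * exp (t * M) * 0"
    by (intro tendsto_intros m r)
  then have "(\<lambda>k. (m k * \<epsilon> k) * exp (m k * \<epsilon> k * M) * norm ((u k - w k) /\<^sub>R \<epsilon> k))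
      \<longlonglongrightarrow> 0"
    by simp
  with always_eventually[OF allI[OF bound]] have "(\<lambda>k. u k ^ m k - w k ^ m k) \<longlonglongrightarrow> 0"
    by (rule Lim_null_comparison)
  moreover have "(\<lambda>k. w k ^ m k) \<longlonglongrightarrow> exp (t *\<^sub>R Z)"
  proof -
    have "w k ^ m k = exp ((m k * \<epsilon> k) *\<^sub>R Z)" for k
      by (simp add: w_def exp_scaleR_power)
    moreover have "(\<lambda>k. exp ((m k * \<epsilon> k) *\<^sub>R Z)) \<longlonglongrightarrow> exp (t *\<^sub>R Z)"
      by (rule isCont_tendsto_compose[OF has_vector_derivative_continuous
            [OF exp_scaleR_has_vector_derivative_right] m])
    ultimately show ?thesis by simp
  qed
  ultimately show ?thesis
    using tendsto_add by fastforce
qed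

context fin_dim_algebra
begin

lemma power_tendsto_Exp:
  assumes e: "\<epsilon> \<longlonglongrightarrow> 0" "\<And>k. \<epsilon> k > (0::real)"
    and Z: "(\<lambda>k. (u k - unit) /\<^sub>R \<epsilon> k) \<longlonglongrightarrow> Z"
    and m: "(\<lambda>k. real (m k) * \<epsilon> k) \<longlonglongrightarrow> t"
  shows "(\<lambda>k. ((\<odot>) (u k) ^^ m k) unit) \<longlonglongrightarrow> Exp (t *\<^sub>R Z)"
proof -
  interpret Lmult: bounded_linear Lmult
    by (rule bounded_linear_Lmult)
  have "(\<lambda>k. (Lmult (u k) - 1) /\<^sub>R \<epsilon> k) \<longlonglongrightarrow> Lmult Z"
    using Lmult.tendsto[OF Z] by (simp add: Lmult.scaleR Lmult.diff Lmult_unit)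
  from power_tendsto_exp[OF e this m]
  have "(\<lambda>k. Lmult (u k) ^ m k) \<longlonglongrightarrow> Lmult (Exp (t *\<^sub>R Z))"
    by (simp add: exp_Lmult flip: Lmult.scaleR)
  from bounded_linear.tendsto[OF endo_apply.bounded_linear_left this, of unit]
  have "(\<lambda>k. endo_apply (Lmult (u k) ^ m k) unit) \<longlonglongrightarrow> Exp (t *\<^sub>R Z)"
    by simp
  moreover have "endo_apply (Lmult x) = (\<odot>) x" for x
    by (rule ext) simp
  ultimately show ?thesis
    by (simp add: endo_apply_power)
qed

text \<open>
  The limit condition is required only for limits that are units: this is closedness relative to the group
  of units, since for example the positive multiples of 1 accumulate at 0.
\<close>

definition closed_group :: "'a set \<Rightarrow> bool" where
  "closed_group \<Gamma> \<longleftrightarrow> unit \<in> \<Gamma> \<and> (\<forall>x\<in>\<Gamma>. \<forall>y\<in>\<Gamma>. x \<odot> y \<in> \<Gamma>) \<and>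
     (\<forall>x\<in>\<Gamma>. \<exists>y\<in>\<Gamma>. x \<odot> y = unit \<and> y \<odot> x = unit) \<and>
     (\<forall>X x y. (\<forall>k. X k \<in> \<Gamma>) \<longrightarrow> X \<longlonglongrightarrow> x \<longrightarrow> x \<odot> y = unit \<longrightarrow> y \<odot> x = unit \<longrightarrow> x \<in> \<Gamma>)"

definition Lie :: "'a set \<Rightarrow> 'a set" where
  "Lie \<Gamma> = {x. \<forall>t. Exp (t *\<^sub>R x) \<in> \<Gamma>}"

lemma inverse_unique:
  assumes "x \<odot> y = unit" "z \<odot> x = unit"
  shows "y = z"
  by (metis assms mult_assoc unit_left unit_right)

lemma closed_groupD:
  assumes "closed_group \<Gamma>"
  shows "unit \<in> \<Gamma>"
    and "x \<in> \<Gamma> \<Longrightarrow> y \<in> \<Gamma> \<Longrightarrow> x \<odot> y \<in> \<Gamma>"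
    and "x \<in> \<Gamma> \<Longrightarrow> \<exists>y\<in>\<Gamma>. x \<odot> y = unit \<and> y \<odot> x = unit"
    and "x \<in> \<Gamma> \<Longrightarrow> x \<odot> z = unit \<Longrightarrow> z \<in> \<Gamma>"
    and "(\<And>k. X k \<in> \<Gamma>) \<Longrightarrow> X \<longlonglongrightarrow> x \<Longrightarrow> x \<odot> y = unit \<Longrightarrow> y \<odot> x = unit \<Longrightarrow> x \<in> \<Gamma>"
proof -
  show inv: "\<exists>y\<in>\<Gamma>. x \<odot> y = unit \<and> y \<odot> x = unit" if "x \<in> \<Gamma>" for x
    using assms that unfolding closed_group_def by simp
  show "z \<in> \<Gamma>" if "x \<in> \<Gamma>" "x \<odot> z = unit"
    using inv[OF that(1)] inverse_unique[OF that(2)] by auto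
  show "x \<in> \<Gamma>" if "\<And>k. X k \<in> \<Gamma>" "X \<longlonglongrightarrow> x" "x \<odot> y = unit" "y \<odot> x = unit"
    using assms that unfolding closed_group_def by blast
qed (use assms in \<open>simp_all add: closed_group_def\<close>)

text \<open>
  Approximate \<open>Exp (t *\<^sub>R Z)\<close> by the power of \<open>u k\<close> whose exponent is
  \<open>t / \<epsilon> k\<close> rounded down; the limit is a unit and so belongs to the group.
\<close>

lemma tangent_in_Lie:
  assumes \<Gamma>: "closed_group \<Gamma>" and u: "\<And>k. u k \<in> \<Gamma>"
    and e: "\<epsilon> \<longlonglongrightarrow> 0" "\<And>k. \<epsilon> k > (0::real)"
    and Z: "(\<lambda>k. (u k - unit) /\<^sub>R \<epsilon> k) \<longlonglongrightarrow> Z"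
  shows "Z \<in> Lie \<Gamma>"
proof -
  have pos: "Exp (t *\<^sub>R Z) \<in> \<Gamma>" if "t \<ge> 0" for t
  proof -
    define m where "m k = nat \<lfloor>t / \<epsilon> k\<rfloor>" for k
    have "\<bar>real (m k) * \<epsilon> k - t\<bar> \<le> \<epsilon> k" for k
    proof -
      have "real (m k) \<le> t / \<epsilon> k" "t / \<epsilon> k \<le> real (m k) + 1"
        unfolding m_def using that e(2)[of k] by simp_all
      then show ?thesis
        using e(2)[of k] by (simp add: field_simps abs_le_iff)
    qed
    then have "(\<lambda>k. real (m k) * \<epsilon> k - t) \<longlonglongrightarrow> 0"
      by (intro Lim_null_comparison[OF always_eventually e(1)] allI) (simp only: real_norm_def)
    then have "(\<lambda>k. real (m k) * \<epsilon> k) \<longlonglongrightarrow> t"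
      by (simp add: LIM_zero_iff)
    from power_tendsto_Exp[OF e Z this] show ?thesis
    proof (rule closed_groupD(5)[OF \<Gamma>, rotated, OF _ Exp_inverse])
      show "((\<odot>) (u k) ^^ m k) unit \<in> \<Gamma>" for k
        by (rule funpow_closed) (use closed_groupD(1,2)[OF \<Gamma>] u in blast)+
    qed
  qed
  have "Exp (t *\<^sub>R Z) \<in> \<Gamma>" for t
  proof (cases "t \<ge> 0")
    case False
    then show ?thesis
      using closed_groupD(4)[OF \<Gamma> pos[of "-t"] Exp_inverse(2)] by simp
  qed (rule pos)
  then show ?thesis
    by (simp add: Lie_def)
qed

text \<open>
  For sums, \<open>x + y\<close> is the tangent at 0 of the curve \<open>Exp (t *\<^sub>R x) \<odot> Exp (t
  *\<^sub>R y)\<close> in the group.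
\<close>

lemma subspace_Lie:
  assumes \<Gamma>: "closed_group \<Gamma>"
  shows "subspace (Lie \<Gamma>)"
proof (rule subspaceI)
  show "0 \<in> Lie \<Gamma>"
    using closed_groupD(1)[OF \<Gamma>] by (simp add: Lie_def)
next
  fix x y assume xy: "x \<in> Lie \<Gamma>" "y \<in> Lie \<Gamma>"
  define \<epsilon> where "\<epsilon> k = inverse (real (Suc k))" for k
  have e: "\<epsilon> \<longlonglongrightarrow> 0" "\<And>k. \<epsilon> k > 0"
    unfolding \<epsilon>_def using LIMSEQ_inverse_real_of_nat by auto
  have "((\<lambda>t. Exp (t *\<^sub>R x) \<odot> Exp (t *\<^sub>R y)) has_vector_derivative
      (Exp (0 *\<^sub>R x) \<odot> (Exp (0 *\<^sub>R y) \<odot> y) + Exp (0 *\<^sub>R x) \<odot> x \<odot> Exp (0 *\<^sub>R y))) (at 0)"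
    by (rule mult.has_vector_derivative; rule Exp_has_vector_derivative)
  from difference_quotient_seq[OF this e(1)] e(2)
  have "(\<lambda>k. (Exp (\<epsilon> k *\<^sub>R x) \<odot> Exp (\<epsilon> k *\<^sub>R y) - unit) /\<^sub>R \<epsilon> k) \<longlonglongrightarrow> x + y"
    by (simp add: less_imp_neq[symmetric] add.commute)
  with \<Gamma> show "x + y \<in> Lie \<Gamma>"
    using xy closed_groupD(2)[OF \<Gamma>] by (intro tangent_in_Lie[OF \<Gamma> _ e]) (auto simp: Lie_def)
qed (simp add: Lie_def)

lemma Lie_conj:
  assumes \<Gamma>: "closed_group \<Gamma>" and "y \<in> Lie \<Gamma>"
    and g: "g \<in> \<Gamma>" "g' \<in> \<Gamma>" "g \<odot> g' = unit" "g' \<odot> g = unit"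
  shows "g \<odot> y \<odot> g' \<in> Lie \<Gamma>"
proof -
  have "Exp (t *\<^sub>R (g \<odot> y \<odot> g')) = g \<odot> Exp (t *\<^sub>R y) \<odot> g'" for t
    using Exp_conj[OF g(3,4), of "t *\<^sub>R y"] by (simp add: mult.scaleR_left mult.scaleR_right)
  then show ?thesis
    using assms closed_groupD(2)[OF \<Gamma>] by (auto simp: Lie_def)
qed

text \<open>
  The bracket is the derivative of a curve of conjugates of \<open>y\<close>, which stays in the Lie
  algebra, a closed set.
\<close>

lemma Lie_bracket:
  assumes \<Gamma>: "closed_group \<Gamma>" and x: "x \<in> Lie \<Gamma>" and y: "y \<in> Lie \<Gamma>"
  shows "y \<odot> x - x \<odot> y \<in> Lie \<Gamma>"
proof -
  define \<epsilon> where "\<epsilon> k = inverse (real (Suc k))" for k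
  have e: "\<epsilon> \<longlonglongrightarrow> 0" "\<And>k. \<epsilon> k \<noteq> 0"
    unfolding \<epsilon>_def using LIMSEQ_inverse_real_of_nat by auto
  show ?thesis
  proof (rule closed_sequentially[OF closed_subspace[OF subspace_Lie[OF \<Gamma>]]])
    show "(\<lambda>k. (Exp (- \<epsilon> k *\<^sub>R x) \<odot> y \<odot> Exp (\<epsilon> k *\<^sub>R x) - y) /\<^sub>R \<epsilon> k) \<longlonglongrightarrow> y \<odot> x - x \<odot> y"
      using difference_quotient_seq[OF Exp_conj_has_vector_derivative e] by simp
    have "Exp (- t *\<^sub>R x) \<odot> y \<odot> Exp (t *\<^sub>R x) \<in> Lie \<Gamma>" for t
      using x by (intro Lie_conj[OF \<Gamma> y] Exp_inverse) (simp_all only: Lie_def mem_Collect_eq)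
    then show "(Exp (- \<epsilon> k *\<^sub>R x) \<odot> y \<odot> Exp (\<epsilon> k *\<^sub>R x) - y) /\<^sub>R \<epsilon> k \<in> Lie \<Gamma>" for k
      by (intro subspace_scale subspace_diff subspace_Lie[OF \<Gamma>] y)
  qed
qed

text \<open>
  From \<open>unit - i k = i k \<odot> (h k - unit)\<close> one first sees that \<open>i k\<close> is
  bounded and then that it converges.
\<close>

lemma inverse_seq_tendsto_unit:
  assumes h: "h \<longlonglongrightarrow> unit" and i: "\<And>k. i k \<odot> h k = unit"
  shows "i \<longlonglongrightarrow> unit"
proof -
  obtain K where K: "norm (x \<odot> y) \<le> norm x * norm y * K" "K > 0" for x y
    using mult.pos_bounded by blast
  have diff: "norm (unit - i k) \<le> norm (i k) * (norm (h k - unit) * K)" for k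
    using K(1)[of "i k" "h k - unit"] by (simp add: i mult.diff_right mult.assoc)
  have hK: "(\<lambda>k. norm (h k - unit) * K) \<longlonglongrightarrow> 0"
    using tendsto_mult_left_zero[OF tendsto_norm_zero[OF LIM_zero[OF h]]] .
  then have "\<forall>\<^sub>F k in sequentially. norm (h k - unit) * K < 1 / 2"
    by (rule order_tendstoD) simp
  then have "\<forall>\<^sub>F k in sequentially. norm (i k - unit) \<le> 2 * norm unit * (norm (h k - unit) * K)"
  proof eventually_elim
    case (elim k)
    have "norm (i k) \<le> norm unit + norm (i k) * (norm (h k - unit) * K)"
      using diff[of k] norm_triangle_ineq2[of "i k" unit] by (simp add: norm_minus_commute)
    also have "norm (i k) * (norm (h k - unit) * K) \<le> norm (i k) * (1 / 2)"
      using elim by (intro mult_left_mono) auto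
    finally have "norm (i k) \<le> 2 * norm unit" by simp
    then have "norm (i k) * (norm (h k - unit) * K) \<le> 2 * norm unit * (norm (h k - unit) * K)"
      using K(2) by (intro mult_right_mono) auto
    with diff[of k] show ?case by (simp add: norm_minus_commute)
  qed
  moreover have "(\<lambda>k. 2 * norm unit * (norm (h k - unit) * K)) \<longlonglongrightarrow> 0"
    using tendsto_mult_right_zero[OF hK] .
  ultimately have "(\<lambda>k. i k - unit) \<longlonglongrightarrow> 0"
    by (rule Lim_null_comparison)
  then show ?thesis by (simp add: LIM_zero_iff)
qed

text \<open>
  The core of the correspondence between groups and Lie algebras. The distance to \<open>H\<close> need not
  be attained, as \<open>H\<close> is closed only among units; a point within twice the distance is enough,
  because the improved point \<open>?h\<close> at the end of the proof is closer by an arbitrarily large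
  factor.
\<close>

lemma closed_subgroup_nhd_unit:
  assumes \<Gamma>: "closed_group \<Gamma>" and H: "closed_group H" and sub: "H \<subseteq> \<Gamma>"
    and Lie: "Lie \<Gamma> \<subseteq> Lie H"
  shows "\<exists>\<delta>>0. \<forall>g\<in>\<Gamma>. norm (g - unit) < \<delta> \<longrightarrow> g \<in> H"
proof (rule ccontr)
  assume "\<not> ?thesis"
  then have "\<exists>g\<in>\<Gamma>. norm (g - unit) < inverse (real (Suc k)) \<and> g \<notin> H" for k
    by (metis inverse_positive_iff_positive of_nat_0_less_iff zero_less_Suc)
  then obtain g where g: "\<And>k. g k \<in> \<Gamma>" "\<And>k. norm (g k - unit) < inverse (real (Suc k))"
      "\<And>k. g k \<notin> H"
    by metis
  have "H \<noteq> {}" using closed_groupD(1)[OF H] by blast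
  have pos: "infdist (g k) H > 0" for k
  proof (rule ccontr)
    assume "\<not> infdist (g k) H > 0"
    then have "g k \<in> closure H"
      using \<open>H \<noteq> {}\<close> infdist_nonneg[of "g k" H] by (simp add: in_closure_iff_infdist_zero)
    then obtain X where "\<And>n. X n \<in> H" "X \<longlonglongrightarrow> g k"
      by (meson closure_sequential)
    with closed_groupD(3)[OF \<Gamma> g(1)[of k]] closed_groupD(5)[OF H] g(3)[of k]
    show False by blast
  qed
  \<comment> \<open>\<open>h k\<close> is a near-minimiser of the distance, \<open>d\<close> the direction from it to \<open>g k\<close>.\<close>
  have "\<exists>h\<in>H. dist (g k) h < 2 * infdist (g k) H" for k
    using infdist_notempty[OF \<open>H \<noteq> {}\<close>, of "g k"] pos[of k] \<open>H \<noteq> {}\<close>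
      cInf_lessD[of "dist (g k) ` H" "2 * infdist (g k) H"] by auto
  then obtain h where h: "\<And>k. h k \<in> H" "\<And>k. dist (g k) (h k) < 2 * infdist (g k) H"
    by metis
  define \<epsilon> where "\<epsilon> k = norm (g k - h k)" for k
  have e2: "\<epsilon> k < 2 * infdist (g k) H" for k
    using h(2)[of k] by (simp add: \<epsilon>_def dist_norm)
  have e_pos: "\<epsilon> k > 0" for k
    using g(3) h(1) by (metis \<epsilon>_def eq_iff_diff_eq_0 zero_less_norm_iff)
  have "g \<longlonglongrightarrow> unit"
    by (rule LIMSEQ_norm_0[of "\<lambda>k. g k - unit", unfolded LIM_zero_iff])
      (use g(2) in \<open>simp add: inverse_eq_divide\<close>)
  have e_lim: "\<epsilon> \<longlonglongrightarrow> 0"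
  proof (rule Lim_null_comparison)
    have "infdist (g k) H \<le> norm (g k - unit)" for k
      using infdist_le[OF closed_groupD(1)[OF H], of "g k"] by (simp add: dist_norm)
    then have "\<epsilon> k \<le> 2 * norm (g k - unit)" for k
      using e2[of k] by (smt (verit))
    then show "\<forall>\<^sub>F k in sequentially. norm (\<epsilon> k) \<le> 2 * norm (g k - unit)"
      using e_pos by (simp add: less_imp_le)
    show "(\<lambda>k. 2 * norm (g k - unit)) \<longlonglongrightarrow> 0"
      by (rule tendsto_mult_right_zero[OF tendsto_norm_zero[OF LIM_zero[OF \<open>g \<longlonglongrightarrow> unit\<close>]]])
  qed
  have "(\<lambda>k. g k - h k) \<longlonglongrightarrow> 0"
    using e_lim unfolding \<epsilon>_def by (rule tendsto_norm_zero_cancel)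
  from tendsto_diff[OF \<open>g \<longlonglongrightarrow> unit\<close> this] have "h \<longlonglongrightarrow> unit" by simp
  obtain i where i: "\<And>k. i k \<in> H" "\<And>k. i k \<odot> h k = unit" "\<And>k. h k \<odot> i k = unit"
    using closed_groupD(3)[OF H h(1)] by metis
  have i_lim: "i \<longlonglongrightarrow> unit"
    by (rule inverse_seq_tendsto_unit[OF \<open>h \<longlonglongrightarrow> unit\<close> i(2)])
  define d where "d k = (g k - h k) /\<^sub>R \<epsilon> k" for k
  have "d k \<in> sphere 0 1" for k
    using e_pos[of k] by (simp add: d_def \<epsilon>_def)
  then obtain Z r where r: "strict_mono (r :: nat \<Rightarrow> nat)" and Z: "(d \<circ> r) \<longlonglongrightarrow> Z"
    using compact_sphere[of "0 :: 'a" 1] unfolding compact_def by (metis (full_types))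
  have e_lim': "(\<lambda>k. \<epsilon> (r k)) \<longlonglongrightarrow> 0" and h_lim: "(\<lambda>k. h (r k)) \<longlonglongrightarrow> unit"
    and i_lim': "(\<lambda>k. i (r k)) \<longlonglongrightarrow> unit" and Z: "(\<lambda>k. d (r k)) \<longlonglongrightarrow> Z"
    using LIMSEQ_subseq_LIMSEQ[OF e_lim r] LIMSEQ_subseq_LIMSEQ[OF \<open>h \<longlonglongrightarrow> unit\<close> r]
      LIMSEQ_subseq_LIMSEQ[OF i_lim r] Z by (simp_all add: o_def)
  \<comment> \<open>Translating by \<open>i k\<close>, the inverse of \<open>h k\<close>, moves the secants to the unit and does not change their limit.\<close>
  have "Z \<in> Lie \<Gamma>"
  proof (rule tangent_in_Lie[OF \<Gamma> _ e_lim' e_pos])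
    show "i (r k) \<odot> g (r k) \<in> \<Gamma>" for k
      using i(1) g(1) sub closed_groupD(2)[OF \<Gamma>] by blast
    have "(i (r k) \<odot> g (r k) - unit) /\<^sub>R \<epsilon> (r k) = i (r k) \<odot> d (r k)" for k
      by (simp add: d_def mult.scaleR_right mult.diff_right i(2))
    then show "(\<lambda>k. (i (r k) \<odot> g (r k) - unit) /\<^sub>R \<epsilon> (r k)) \<longlonglongrightarrow> Z"
      using mult.tendsto[OF i_lim' Z] by simp
  qed
  then have Z_H: "Exp (t *\<^sub>R Z) \<in> H" for t
    using Lie by (auto simp: Lie_def)
  \<comment> \<open>Move \<open>h k\<close> by the distance \<open>\<epsilon> k\<close> in direction \<open>Z\<close>; the remaining distance is \<open>o(\<epsilon> k)\<close>.\<close>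
  define q where "q k = (Exp (\<epsilon> (r k) *\<^sub>R Z) - unit) /\<^sub>R \<epsilon> (r k)" for k
  have q: "q \<longlonglongrightarrow> Z"
    unfolding q_def
    using difference_quotient_seq[OF Exp_has_vector_derivative[of Z 0] e_lim'] e_pos
    by (simp add: less_imp_neq[symmetric])
  have "(\<lambda>k. norm (d (r k) - h (r k) \<odot> q k)) \<longlonglongrightarrow> norm (Z - unit \<odot> Z)"
    by (intro tendsto_intros mult.tendsto Z h_lim q)
  then have "(\<lambda>k. norm (d (r k) - h (r k) \<odot> q k)) \<longlonglongrightarrow> 0"
    by simp
  then have "\<forall>\<^sub>F k in sequentially. norm (d (r k) - h (r k) \<odot> q k) < 1 / 2"
    by (rule order_tendstoD(2)) simp
  then obtain k where k: "norm (d (r k) - h (r k) \<odot> q k) < 1 / 2"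
    by (auto simp: eventually_sequentially)
  let ?h = "h (r k) \<odot> Exp (\<epsilon> (r k) *\<^sub>R Z)"
  have "g (r k) - ?h = \<epsilon> (r k) *\<^sub>R (d (r k) - h (r k) \<odot> q k)"
    using e_pos[of "r k"]
    by (simp add: d_def q_def scaleR_diff_right mult.scaleR_right mult.diff_right)
  then have "norm (g (r k) - ?h) < \<epsilon> (r k) / 2"
    using k e_pos[of "r k"] by simp
  moreover have "infdist (g (r k)) H \<le> norm (g (r k) - ?h)"
    using infdist_le[OF closed_groupD(2)[OF H h(1) Z_H]] by (simp add: dist_norm)
  ultimately show False
    using e2[of "r k"] by simp
qed

text \<open>A subgroup containing a neighbourhood of the unit is open; it is also closed in the connected \<open>\<Gamma>\<close>.\<close>

lemma closed_subgroup_eq: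
  assumes \<Gamma>: "closed_group \<Gamma>" and H: "closed_group H" and sub: "H \<subseteq> \<Gamma>"
    and Lie: "Lie \<Gamma> \<subseteq> Lie H" and conn: "connected \<Gamma>"
  shows "H = \<Gamma>"
proof -
  obtain \<delta> where \<delta>: "\<delta> > 0" "\<And>g. g \<in> \<Gamma> \<Longrightarrow> norm (g - unit) < \<delta> \<Longrightarrow> g \<in> H"
    using closed_subgroup_nhd_unit[OF \<Gamma> H sub Lie] by blast
  have "openin (top_of_set \<Gamma>) H"
    unfolding openin_contains_ball
  proof (intro conjI sub ballI)
    fix h assume "h \<in> H"
    then obtain i where i: "i \<in> H" "i \<odot> h = unit" "h \<odot> i = unit"
      using closed_groupD(3)[OF H] by blast
    have "isCont (\<lambda>g. i \<odot> g) h"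
      by (rule linear_continuous_at[OF mult.bounded_linear_right])
    then obtain e where e: "e > 0" "\<And>g. dist g h < e \<Longrightarrow> dist (i \<odot> g) (i \<odot> h) < \<delta>"
      using \<delta>(1) unfolding continuous_at_eps_delta by blast
    have "g \<in> H" if "g \<in> ball h e \<inter> \<Gamma>" for g
    proof -
      have "i \<odot> g \<in> H"
        using e(2)[of g] that i sub closed_groupD(2)[OF \<Gamma>]
        by (intro \<delta>(2)) (auto simp: dist_norm norm_minus_commute)
      then have "h \<odot> (i \<odot> g) \<in> H"
        using closed_groupD(2)[OF H \<open>h \<in> H\<close>] by blast
      then show ?thesis
        using i(3) by (simp flip: mult_assoc)
    qed
    then show "\<exists>e>0. ball h e \<inter> \<Gamma> \<subseteq> H"
      using e(1) by blast
  qed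
  moreover have "closedin (top_of_set \<Gamma>) H"
    unfolding closedin_closed
  proof (intro exI conjI closed_closure equalityI subsetI IntI)
    fix g assume "g \<in> \<Gamma> \<inter> closure H"
    then obtain X where "\<And>n. X n \<in> H" "X \<longlonglongrightarrow> g" "g \<in> \<Gamma>"
      by (auto simp: closure_sequential)
    then show "g \<in> H"
      using closed_groupD(3)[OF \<Gamma>, of g] closed_groupD(5)[OF H] by blast
  qed (use sub closure_subset in auto)
  ultimately show ?thesis
    using conn closed_groupD(1)[OF H] unfolding connected_clopen by blast
qed

end

section \<open>Polynomials in a matrix and eigenvectors modulo a subspace\<close>

text \<open>
  Statements about the quotient by \<open>U\<close> are expressed by congruences modulo \<open>U\<close>: an
  eigenvector of \<open>A\<close> in the quotient by \<open>U\<close> is a vector \<open>v \<notin>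
  U\<close> with \<open>A *v v - c *s v \<in> U\<close>. The vector \<open>poly_act p A v\<close> is
  \<open>p(A) v\<close>.
\<close>

definition poly_act :: "'a::field poly \<Rightarrow> 'a^'n^'n \<Rightarrow> 'a^'n \<Rightarrow> 'a^'n" where
  "poly_act p A v = (\<Sum>i\<le>degree p. coeff p i *s (((*v) A ^^ i) v))"

lemma matrix_vector_mult_sum_right:
  fixes A :: "'a::field^'n^'m"
  shows "A *v (\<Sum>i\<in>I. f i) = (\<Sum>i\<in>I. A *v f i)"
  by (induction I rule: infinite_finite_induct) (simp_all add: matrix_vector_right_distrib)

lemma poly_act_0 [simp]: "poly_act 0 A v = 0"
  by (simp add: poly_act_def)

lemma poly_act_eq_sum:
  assumes "degree p \<le> N"
  shows "poly_act p A v = (\<Sum>i\<le>N. coeff p i *s (((*v) A ^^ i) v))"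
  unfolding poly_act_def
  by (rule sum.mono_neutral_left) (use assms in \<open>auto simp: coeff_eq_0\<close>)

lemma poly_act_pCons: "poly_act (pCons a p) A v = a *s v + A *v poly_act p A v"
proof -
  have "poly_act (pCons a p) A v = (\<Sum>i\<le>Suc (degree p). coeff (pCons a p) i *s (((*v) A ^^ i) v))"
    by (rule poly_act_eq_sum) (simp add: degree_pCons_le)
  also have "\<dots> = a *s v + (\<Sum>i\<le>degree p. coeff p i *s (A *v (((*v) A ^^ i) v)))"
    by (subst sum.atMost_Suc_shift) simp
  also have "\<dots> = a *s v + A *v poly_act p A v"
    by (simp add: poly_act_def matrix_vector_mult_sum_right vector_scalar_commute)
  finally show ?thesis .
qed

lemma poly_act_linear_factor:
  "poly_act ([:- c, 1:] * q) A v = A *v poly_act q A v - c *s poly_act q A v"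
proof (induction q)
  case (pCons a q)
  have "[:- c, 1:] * pCons a q = pCons (- c * a) ([:a:] + [:- c, 1:] * q)"
    by (simp add: algebra_simps)
  moreover have "poly_act ([:a:] + [:- c, 1:] * q) A v = a *s v + poly_act ([:- c, 1:] * q) A v"
  proof -
    obtain b r where r: "[:- c, 1:] * q = pCons b r"
      by (cases "[:- c, 1:] * q") auto
    show ?thesis
      unfolding r by (simp add: poly_act_pCons vec.scale_left_distrib)
  qed
  ultimately show ?case
    using pCons.IH
    by (simp add: poly_act_pCons matrix_vector_right_distrib matrix_vector_mult_diff_distrib
        vector_scalar_commute vec.scale_right_distrib vector_smult_assoc)
qed simp

lemma poly_act_in_subspace:
  assumes U: "vec.subspace U" and A: "\<And>u. u \<in> U \<Longrightarrow> A *v u \<in> U" and "v \<in> U"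
  shows "poly_act p A v \<in> U"
proof (induction p)
  case (pCons a p)
  then show ?case
    unfolding poly_act_pCons
    by (intro vec.subspace_add[OF U] vec.subspace_scale[OF U] A \<open>v \<in> U\<close>)
qed (simp add: vec.subspace_0[OF U])

text \<open>It follows that an eigenvalue modulo \<open>U\<close> is a root of every polynomial that annihilates \<open>A\<close>.\<close>

lemma poly_act_eigenvector_mod:
  assumes U: "vec.subspace U" and A: "\<And>u. u \<in> U \<Longrightarrow> A *v u \<in> U" and v: "A *v v - c *s v \<in> U"
  shows "poly_act p A v - poly p c *s v \<in> U"
proof (induction p)
  case 0
  then show ?case by (simp add: vec.subspace_0[OF U])
next
  case (pCons a p)
  have "poly_act (pCons a p) A v - poly (pCons a p) c *s v
    = A *v (poly_act p A v - poly p c *s v) + poly p c *s (A *v v - c *s v)"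
    unfolding poly_act_pCons poly_pCons matrix_vector_mult_diff_distrib vector_scalar_commute
    by (simp add: vec_eq_iff algebra_simps)
  moreover have "\<dots> \<in> U"
    by (intro vec.subspace_add[OF U] vec.subspace_scale[OF U] A pCons.IH v)
  ultimately show ?case by simp
qed

lemma exists_linear_relation:
  fixes M :: "nat \<Rightarrow> 'a::euclidean_space"
  shows "\<exists>a N. (\<exists>i\<le>N. a i \<noteq> 0) \<and> (\<Sum>i\<le>N. a i *\<^sub>R M i) = 0"
proof (cases "inj_on M {..DIM('a)}")
  case True
  then have "card (M ` {..DIM('a)}) > DIM('a)"
    by (simp add: card_image)
  then have "dependent (M ` {..DIM('a)})"
    by (intro dependent_biggerset) auto
  then obtain u where u: "\<exists>v\<in>M ` {..DIM('a)}. u v \<noteq> 0" "(\<Sum>v\<in>M ` {..DIM('a)}. u v *\<^sub>R v) = 0"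
    using dependent_finite[of "M ` {..DIM('a)}"] by auto
  have "(\<Sum>i\<le>DIM('a). u (M i) *\<^sub>R M i) = 0"
    using u(2) True by (simp add: sum.reindex)
  with u(1) show ?thesis
    by (intro exI[of _ "\<lambda>i. u (M i)"] exI[of _ "DIM('a)"]) auto
next
  case False
  then obtain i j where ij: "i \<noteq> j" "i \<le> DIM('a)" "j \<le> DIM('a)" "M i = M j"
    by (auto simp: inj_on_def)
  have "(\<Sum>k\<le>DIM('a). (of_bool (k = i) - of_bool (k = j)) *\<^sub>R M k) = M i - M j"
    using ij by (simp add: scaleR_diff_left sum_subtractf of_bool_def if_distrib[of "\<lambda>c. c *\<^sub>R _"]
        sum.delta cong: if_cong)
  with ij show ?thesis
    by (intro exI[of _ "\<lambda>k. of_bool (k = i) - of_bool (k = j)"] exI[of _ "DIM('a)"]) auto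
qed

lemma scaleR_eq_vector_scalar: "r *\<^sub>R v = complex_of_real r *s (v :: complex^'n)"
  unfolding vec_eq_iff vector_scaleR_component by (simp add: scaleR_conv_of_real)

lemma scaleR_matrix_vector: "(r *\<^sub>R A) *v v = r *\<^sub>R (A *v (v :: complex^'n))"
  by (simp add: vec_eq_iff matrix_vector_mult_def scaleR_sum_right)

lemma bounded_linear_matrix_apply: "bounded_linear (\<lambda>A :: complex^'n^'m. A *v v)"
  unfolding linear_conv_bounded_linear[symmetric]
  by (rule linearI) (simp_all add: matrix_vector_mult_add_rdistrib scaleR_matrix_vector)

text \<open>The powers of \<open>A\<close> are linearly dependent, even over the reals.\<close>

lemma exists_annihilating_poly:
  fixes A :: "complex^'d^'d"
  shows "\<exists>p. p \<noteq> 0 \<and> (\<forall>v. poly_act p A v = 0)"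
proof -
  have pow: "((**) A ^^ i) (mat 1) *v v = ((*v) A ^^ i) v" for i v
    by (induction i) (simp_all flip: matrix_vector_mul_assoc)
  obtain a N where a: "\<exists>i\<le>N. a i \<noteq> 0" and sum: "(\<Sum>i\<le>N. a i *\<^sub>R ((**) A ^^ i) (mat 1)) = 0"
    using exists_linear_relation[of "\<lambda>i. ((**) A ^^ i) (mat 1)"] by blast
  define p where "p = (\<Sum>i\<le>N. monom (complex_of_real (a i)) i)"
  have coeff: "coeff p i = (if i \<le> N then complex_of_real (a i) else 0)" for i
    by (simp add: p_def coeff_sum coeff_monom)
  then have "degree p \<le> N"
    by (intro degree_le) auto
  moreover have "p \<noteq> 0"
    using a coeff by (metis coeff_0 of_real_eq_0_iff)
  moreover have "poly_act p A v = 0" for v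
  proof -
    interpret bounded_linear "\<lambda>A :: complex^'d^'d. A *v v"
      by (rule bounded_linear_matrix_apply)
    have "poly_act p A v = (\<Sum>i\<le>N. a i *\<^sub>R ((**) A ^^ i) (mat 1)) *v v"
      using \<open>degree p \<le> N\<close>
      by (simp add: poly_act_eq_sum coeff pow sum scaleR scaleR_eq_vector_scalar)
    then show ?thesis by (simp add: sum[symmetric] \<open>(\<Sum>i\<le>N. a i *\<^sub>R ((**) A ^^ i) (mat 1)) = 0\<close>)
  qed
  ultimately show ?thesis by blast
qed

text \<open>
  Take \<open>p\<close> of least degree with \<open>p(A) v \<in> U\<close> and split off a linear factor,
  \<open>p = (X - c) q\<close>. By minimality \<open>q(A) v\<close> is not in \<open>U\<close>, and it is an
  eigenvector modulo \<open>U\<close> for \<open>c\<close>.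
\<close>

lemma exists_eigenvector_mod:
  fixes A :: "complex^'d^'d"
  assumes U: "vec.subspace U" and W: "vec.subspace W"
    and AU: "\<And>u. u \<in> U \<Longrightarrow> A *v u \<in> U" and AW: "\<And>w. w \<in> W \<Longrightarrow> A *v w \<in> W"
    and v: "v \<in> W" "v \<notin> U"
  shows "\<exists>w\<in>W. w \<notin> U \<and> (\<exists>c. A *v w - c *s w \<in> U)"
proof -
  have "\<exists>p. p \<noteq> 0 \<and> poly_act p A v \<in> U"
    using exists_annihilating_poly[of A] vec.subspace_0[OF U] by metis
  then obtain p where p: "p \<noteq> 0" "poly_act p A v \<in> U"
    and min: "\<And>q. q \<noteq> 0 \<Longrightarrow> poly_act q A v \<in> U \<Longrightarrow> degree p \<le> degree q"
    using exists_least_iff[of "\<lambda>n. \<exists>p. p \<noteq> 0 \<and> poly_act p A v \<in> U \<and> degree p = n"]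
    by (metis not_le)
  have "\<not> constant (poly p)"
  proof
    assume "constant (poly p)"
    then have "degree p = 0"
      by (simp add: constant_degree)
    then obtain a where a: "p = [:a:]"
      by (metis degree_eq_zeroE)
    with p have "a *s v \<in> U" "a \<noteq> 0"
      by (auto simp: poly_act_pCons)
    then have "inverse a *s (a *s v) \<in> U"
      using vec.subspace_scale[OF U] by blast
    moreover have "inverse a *s (a *s v) = v"
      using \<open>a \<noteq> 0\<close> unfolding vector_smult_assoc by simp
    ultimately show False
      using v(2) by simp
  qed
  then obtain c where "poly p c = 0"
    using fundamental_theorem_of_algebra by blast
  then obtain q where q: "p = [:- c, 1:] * q"
    by (auto simp: poly_eq_0_iff_dvd elim: dvdE)
  with p have "q \<noteq> 0" by auto
  then have "degree p = Suc (degree q)"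
    unfolding q by (subst degree_mult_eq) auto
  with min[OF \<open>q \<noteq> 0\<close>] have "poly_act q A v \<notin> U" by auto
  moreover have "A *v poly_act q A v - c *s poly_act q A v \<in> U"
    using p(2) unfolding q poly_act_linear_factor .
  moreover have "poly_act q A v \<in> W"
    using W AW v(1) by (rule poly_act_in_subspace)
  ultimately show ?thesis by blast
qed

section \<open>Lie's theorem\<close>

lemma fin_dim_algebra_matrix:
  "fin_dim_algebra ((**) :: 'a::{real_normed_field, euclidean_space}^'n^'n \<Rightarrow> 'a^'n^'n \<Rightarrow> 'a^'n^'n) (mat 1)"
proof
  have "linear (\<lambda>B :: 'a^'n^'n. A ** B)" "linear (\<lambda>B :: 'a^'n^'n. B ** A)" for A :: "'a^'n^'n"
    by (rule linearI; simp add: vec_eq_iff matrix_matrix_mult_def sum.distrib algebra_simps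
        scaleR_sum_right)+
  then show "bilinear ((**) :: 'a^'n^'n \<Rightarrow> 'a^'n^'n \<Rightarrow> 'a^'n^'n)"
    by (simp add: bilinear_def)
qed (simp_all add: matrix_mul_assoc)

interpretation cmat: fin_dim_algebra "(**) :: complex^'d^'d \<Rightarrow> complex^'d^'d \<Rightarrow> complex^'d^'d" "mat 1"
  by (rule fin_dim_algebra_matrix)

lemma complex_subspace_imp_subspace: "vec.subspace U \<Longrightarrow> subspace (U :: (complex^'n) set)"
  by (simp add: vec.subspace_def subspace_def scaleR_eq_vector_scalar)

lemma cmat_Exp_invariant:
  assumes U: "vec.subspace U" and A: "\<And>u. u \<in> U \<Longrightarrow> A *v u \<in> U" and u: "u \<in> U"
  shows "cmat.Exp (t *\<^sub>R A) *v u \<in> U"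
proof -
  define B where "B = t *\<^sub>R A"
  have B: "B *v u \<in> U" if "u \<in> U" for u
    using A that U by (simp add: B_def scaleR_matrix_vector scaleR_eq_vector_scalar vec.subspace_scale)
  have pow: "((**) B ^^ i) (mat 1) *v u \<in> U" for i
    by (induction i) (simp_all add: u B flip: matrix_vector_mul_assoc)
  have sU: "subspace U"
    using U by (rule complex_subspace_imp_subspace)
  have "(\<lambda>k. ((1 / fact k) *\<^sub>R ((**) B ^^ k) (mat 1)) *v u) sums (cmat.Exp B *v u)"
    by (rule bounded_linear.sums[OF bounded_linear_matrix_apply cmat.Exp_sums])
  then have "cmat.Exp B *v u \<in> U"
    unfolding sums_def
    by (rule closed_sequentially[OF closed_subspace[OF sU], rotated])
      (intro subspace_sum[OF sU], simp add: scaleR_matrix_vector subspace_scale[OF sU] pow)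
  then show ?thesis by (simp add: B_def)
qed

text \<open>Such a functional reads off the eigenvalue of an eigenvector \<open>v\<close> modulo \<open>U\<close>.\<close>

lemma exists_functional_vanishing_on:
  fixes U :: "(complex^'d) set"
  assumes U: "vec.subspace U" and v: "v \<notin> U"
  shows "\<exists>\<phi> :: complex^'d \<Rightarrow> complex. bounded_linear \<phi> \<and> (\<forall>u\<in>U. \<phi> u = 0) \<and> (\<forall>c. \<phi> (c *s v) = c)"
proof -
  obtain B where B: "B \<subseteq> U" "vec.independent B" "U \<subseteq> vec.span B"
    using vec.basis_exists[of U] by metis
  then have "vec.span B = U"
    using U by (meson subset_antisym vec.span_minimal)
  with v B have "v \<notin> B" "vec.independent (insert v B)"
    by (auto simp: vec.independent_insert vec.span_base)
  then obtain g where g: "Vector_Spaces.linear (*s) (*s) g"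
      and gB: "\<forall>x\<in>insert v B. g x = (if x = v then v else 0)"
    using vec.linear_independent_extend[of "insert v B" "\<lambda>x. if x = v then v else 0"] by blast
  interpret g: Vector_Spaces.linear "(*s)" "(*s)" g by (rule g)
  have gU: "g u = 0" if "u \<in> U" for u
  proof (rule g.eq_0_on_span)
    show "u \<in> vec.span B" using that \<open>vec.span B = U\<close> by simp
    show "g x = 0" if "x \<in> B" for x using that gB \<open>v \<notin> B\<close> by auto
  qed
  have "v \<noteq> 0" using v vec.subspace_0[OF U] by auto
  then obtain k where k: "v $ k \<noteq> 0" by (auto simp: vec_eq_iff)
  define \<phi> where "\<phi> u = g u $ k / v $ k" for u
  have "linear \<phi>"
    by (rule linearI)
      (simp_all add: \<phi>_def g.add add_divide_distrib scaleR_eq_vector_scalar g.scale scaleR_conv_of_real)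
  then have "bounded_linear \<phi>"
    by (simp add: linear_conv_bounded_linear)
  moreover have "\<phi> (c *s v) = c" for c
    using k gB by (simp add: \<phi>_def g.scale)
  moreover have "\<phi> u = 0" if "u \<in> U" for u
    by (simp add: \<phi>_def gU[OF that])
  ultimately show ?thesis by blast
qed

text \<open>
  If \<open>v\<close> has weight \<open>w\<close> modulo \<open>U\<close>, then \<open>Exp x\<close> maps
  \<open>v\<close> to a vector whose weight is \<open>w\<close> composed with conjugation. Applied to
  \<open>t *\<^sub>R x\<close>, this gives a continuous family \<open>\<mu> t\<close> of eigenvalues of
  \<open>y\<close> modulo \<open>U\<close>. They all are roots of one annihilating polynomial, so
  \<open>\<mu>\<close> is constant, and its derivative at 0 is the weight of the bracket.
\<close>

lemma weight_vanishes_on_bracket: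
  fixes x y :: "complex^'d^'d"
  assumes h: "subspace h" and bracket: "\<And>z. z \<in> h \<Longrightarrow> z ** x - x ** z \<in> h"
    and U: "vec.subspace U" and hU: "\<And>z u. z \<in> h \<Longrightarrow> u \<in> U \<Longrightarrow> z *v u \<in> U"
    and xU: "\<And>u. u \<in> U \<Longrightarrow> x *v u \<in> U"
    and v: "v \<notin> U" and weight: "\<And>z. z \<in> h \<Longrightarrow> z *v v - w z *s v \<in> U"
    and y: "y \<in> h"
  shows "w (y ** x - x ** y) = 0"
proof -
  obtain \<phi> :: "complex^'d \<Rightarrow> complex" where \<phi>: "bounded_linear \<phi>"
    and \<phi>U: "\<And>u. u \<in> U \<Longrightarrow> \<phi> u = 0" and \<phi>v: "\<And>c. \<phi> (c *s v) = c"
    using exists_functional_vanishing_on[OF U v] by blast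
  interpret \<phi>: bounded_linear \<phi> by (rule \<phi>)
  have w: "w z = \<phi> (z *v v)" if "z \<in> h" for z
    using \<phi>U[OF weight[OF that]] by (simp add: \<phi>.diff \<phi>v)
  define E where "E t = cmat.Exp (t *\<^sub>R x)" for t
  define conj where "conj t = E (- t) ** y ** E t" for t
  have E_inv: "E (- t) *v (E t *v u) = u" "E t *v (E (- t) *v u) = u" for t u
    unfolding E_def matrix_vector_mul_assoc cmat.Exp_inverse by simp_all
  have conj_h: "conj t \<in> h" for t
    unfolding conj_def E_def by (rule cmat.Exp_conj_invariant[OF h y bracket])
  have EU: "E t *v u \<in> U" if "u \<in> U" for t u
    unfolding E_def by (rule cmat_Exp_invariant[OF U xU that])
  define \<mu> where "\<mu> t = \<phi> (conj t *v v)" for t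
  obtain p where p: "p \<noteq> 0" "\<And>u. poly_act p y u = 0"
    using exists_annihilating_poly by blast
  have root: "poly p (\<mu> t) = 0" for t
  proof -
    have "conj t *v v - \<mu> t *s v \<in> U"
      using weight[OF conj_h] w[OF conj_h] by (simp add: \<mu>_def)
    then have "E t *v (conj t *v v - \<mu> t *s v) \<in> U" by (rule EU)
    moreover have "E t *v (conj t *v v) = y *v (E t *v v)"
      unfolding conj_def by (simp add: E_inv flip: matrix_vector_mul_assoc)
    ultimately have "y *v (E t *v v) - \<mu> t *s (E t *v v) \<in> U"
      by (simp add: matrix_vector_mult_diff_distrib vector_scalar_commute)
    from poly_act_eigenvector_mod[OF U hU[OF y] this, of p]
    have "poly p (\<mu> t) *s (E t *v v) \<in> U"
      using vec.subspace_neg[OF U] by (fastforce simp: p(2))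
    then have "E (- t) *v (poly p (\<mu> t) *s (E t *v v)) \<in> U" by (rule EU)
    then have "poly p (\<mu> t) *s v \<in> U"
      by (simp add: vector_scalar_commute E_inv)
    from \<phi>U[OF this] show ?thesis by (simp add: \<phi>v)
  qed
  have cont: "continuous_on UNIV \<mu>"
  proof -
    have E: "continuous_on UNIV E"
      unfolding E_def by (rule cmat.continuous_Exp_scaleR)
    have "continuous_on UNIV (\<lambda>t. E (- t))"
      by (rule continuous_on_compose2[OF E]) (auto intro: continuous_intros)
    then have "continuous_on UNIV conj"
      unfolding conj_def by (intro cmat.mult.continuous_on continuous_on_const E)
    then show ?thesis
      unfolding \<mu>_def by (intro \<phi>.continuous_on bounded_linear.continuous_on[OF bounded_linear_matrix_apply])
  qed
  have "finite (range \<mu>)"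
    by (rule finite_subset[OF _ poly_roots_finite[OF p(1)]]) (use root in auto)
  with cont have "\<mu> constant_on UNIV"
    by (intro continuous_finite_range_constant) auto
  then have const: "\<mu> t = \<mu> 0" for t
    by (auto simp: constant_on_def)
  define \<epsilon> where "\<epsilon> k = inverse (real (Suc k))" for k
  have e: "\<epsilon> \<longlonglongrightarrow> 0" "\<And>k. \<epsilon> k \<noteq> 0"
    unfolding \<epsilon>_def using LIMSEQ_inverse_real_of_nat by auto
  have "(\<lambda>k. (conj (\<epsilon> k) - conj 0) /\<^sub>R \<epsilon> k) \<longlonglongrightarrow> y ** x - x ** y"
    unfolding conj_def E_def
    using difference_quotient_seq[OF cmat.Exp_conj_has_vector_derivative e] by simp
  from \<phi>.tendsto[OF bounded_linear.tendsto[OF bounded_linear_matrix_apply this, of v]]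
  have "(\<lambda>k. (\<mu> (\<epsilon> k) - \<mu> 0) /\<^sub>R \<epsilon> k) \<longlonglongrightarrow> \<phi> ((y ** x - x ** y) *v v)"
    by (simp add: \<mu>_def scaleR_matrix_vector \<phi>.scaleR matrix_vector_mult_diff_rdistrib \<phi>.diff)
  moreover have "\<mu> (\<epsilon> k) - \<mu> 0 = 0" for k
    using const[of "\<epsilon> k"] by simp
  ultimately have "\<phi> ((y ** x - x ** y) *v v) = 0"
    by (simp add: LIMSEQ_const_iff)
  then show ?thesis
    using w[OF bracket[OF y]] by simp
qed

text \<open>A common eigenvector of \<open>h\<close> in the quotient by \<open>U\<close>.\<close>

definition common_eigenvector_mod :: "(complex^'d) set \<Rightarrow> (complex^'d^'d) set \<Rightarrow> bool" where
  "common_eigenvector_mod U h \<longleftrightarrow> (\<exists>v. v \<notin> U \<and> (\<forall>y\<in>h. \<exists>c. y *v v - c *s v \<in> U))"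

lemma common_eigenvector_mod_mono:
  "common_eigenvector_mod U h \<Longrightarrow> h' \<subseteq> h \<Longrightarrow> common_eigenvector_mod U h'"
  unfolding common_eigenvector_mod_def by blast

text \<open>
  As the weight vanishes on brackets with \<open>x\<close>, the weight space \<open>W\<close> of
  \<open>h\<close> is invariant under \<open>x\<close>, and an eigenvector of \<open>x\<close> can be found
  inside \<open>W\<close>.
\<close>

lemma common_eigenvector_mod_extend:
  assumes h: "subspace h" and bracket: "\<And>z. z \<in> h \<Longrightarrow> z ** x - x ** z \<in> h"
    and U: "vec.subspace U" and hU: "\<And>z u. z \<in> h \<Longrightarrow> u \<in> U \<Longrightarrow> z *v u \<in> U"
    and xU: "\<And>u. u \<in> U \<Longrightarrow> x *v u \<in> U"
    and ev: "common_eigenvector_mod U h"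
  shows "common_eigenvector_mod U (span (insert x h))"
proof -
  obtain v w where v: "v \<notin> U" and weight: "\<And>z. z \<in> h \<Longrightarrow> z *v v - w z *s v \<in> U"
    using ev unfolding common_eigenvector_mod_def by metis
  have w0: "w (z ** x - x ** z) = 0" if "z \<in> h" for z
    by (rule weight_vanishes_on_bracket[OF h bracket U hU xU v weight that])
  define W where "W = {u. \<forall>z\<in>h. z *v u - w z *s u \<in> U}"
  have W: "vec.subspace W"
  proof (rule vec.subspaceI)
    show "0 \<in> W" by (simp add: W_def vec.subspace_0[OF U])
    show "a + b \<in> W" if "a \<in> W" "b \<in> W" for a b
    proof -
      have "z *v (a + b) - w z *s (a + b) = (z *v a - w z *s a) + (z *v b - w z *s b)" for z
        by (simp add: matrix_vector_right_distrib vec.scale_right_distrib)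
      then show ?thesis
        using that unfolding W_def mem_Collect_eq by (metis vec.subspace_add[OF U])
    qed
    show "c *s a \<in> W" if "a \<in> W" for a c
    proof -
      have "z *v (c *s a) - w z *s (c *s a) = c *s (z *v a - w z *s a)" for z
        by (simp add: vector_scalar_commute vec_eq_iff algebra_simps)
      then show ?thesis
        using that unfolding W_def mem_Collect_eq by (metis vec.subspace_scale[OF U])
    qed
  qed
  have xW: "x *v u \<in> W" if u: "u \<in> W" for u
    unfolding W_def mem_Collect_eq
  proof
    fix z assume z: "z \<in> h"
    have "z *v (x *v u) - w z *s (x *v u)
      = x *v (z *v u - w z *s u) + ((z ** x - x ** z) *v u - w (z ** x - x ** z) *s u)"
      by (simp add: w0[OF z] matrix_vector_mult_diff_rdistrib matrix_vector_mult_diff_distrib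
          vector_scalar_commute matrix_vector_mul_assoc)
    moreover have "\<dots> \<in> U"
      using u z bracket[OF z] unfolding W_def by (intro vec.subspace_add[OF U] xU) auto
    ultimately show "z *v (x *v u) - w z *s (x *v u) \<in> U" by simp
  qed
  have "v \<in> W" using weight by (simp add: W_def)
  then obtain u c where u: "u \<in> W" "u \<notin> U" and c: "x *v u - c *s u \<in> U"
    using exists_eigenvector_mod[OF U W xU xW _ v] by blast
  let ?S = "{z. \<exists>c. z *v u - c *s u \<in> U}"
  have "subspace ?S"
  proof (rule subspaceI)
    show "0 \<in> ?S"
      using vec.subspace_0[OF U] by (auto intro!: exI[of _ 0])
    show "a + b \<in> ?S" if ab: "a \<in> ?S" "b \<in> ?S" for a b
    proof -
      obtain ca cb where "a *v u - ca *s u \<in> U" "b *v u - cb *s u \<in> U"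
        using ab by blast
      from vec.subspace_add[OF U this] show ?thesis
        by (auto simp: matrix_vector_mult_add_rdistrib vec.scale_left_distrib algebra_simps
            intro!: exI[of _ "ca + cb"])
    qed
    show "r *\<^sub>R a \<in> ?S" if a: "a \<in> ?S" for r a
    proof -
      obtain ca where "a *v u - ca *s u \<in> U"
        using a by blast
      from vec.subspace_scale[OF U this, of "complex_of_real r"] show ?thesis
        by (auto simp: scaleR_matrix_vector scaleR_eq_vector_scalar vec.scale_right_diff_distrib
            vector_smult_assoc intro!: exI[of _ "complex_of_real r * ca"])
    qed
  qed
  moreover have "insert x h \<subseteq> ?S"
    using c u(1) unfolding W_def by auto
  ultimately have "span (insert x h) \<subseteq> ?S"
    by (intro span_minimal)
  with u(2) show ?thesis
    unfolding common_eigenvector_mod_def by blast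
qed

text \<open>
  Lie's theorem, for any descending chain that behaves like a derived series. From \<open>L (Suc j)\<close>
  one climbs to \<open>L j\<close> by adjoining the elements of a basis one at a time; each intermediate
  subspace contains \<open>L (Suc j)\<close> and hence all brackets of elements of \<open>L j\<close>.
\<close>

theorem solvable_common_eigenvector_mod:
  fixes L :: "nat \<Rightarrow> (complex^'d^'d) set"
  assumes sub: "\<And>j. subspace (L j)" and decr: "\<And>j. L (Suc j) \<subseteq> L j"
    and bracket: "\<And>j x y. x \<in> L j \<Longrightarrow> y \<in> L j \<Longrightarrow> y ** x - x ** y \<in> L (Suc j)"
    and trivial: "L k \<subseteq> {0}"
    and U: "vec.subspace U" "U \<noteq> UNIV" and LU: "\<And>y u. y \<in> L 0 \<Longrightarrow> u \<in> U \<Longrightarrow> y *v u \<in> U"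
  shows "common_eigenvector_mod U (L 0)"
proof -
  have L0: "L j \<subseteq> L 0" for j
    by (induction j) (use decr in auto)
  have "common_eigenvector_mod U (L j)" if "j \<le> k" for j
    using that
  proof (induction rule: inc_induct)
    case base
    obtain v where "v \<notin> U" using U(2) by blast
    then show ?case
      using trivial vec.subspace_0[OF U(1)] unfolding common_eigenvector_mod_def
      by (intro exI[of _ v]) (auto intro!: exI[of _ 0])
  next
    case (step j)
    have fin: "common_eigenvector_mod U (span (L (Suc j) \<union> F))" if "finite F" "F \<subseteq> L j" for F
      using that
    proof (induction F rule: finite_induct)
      case empty
      show ?case
        unfolding Un_empty_right span_eq_iff[THEN iffD2, OF sub[of "Suc j"]] by (rule step.IH)
    next
      case (insert x F)
      let ?h = "span (L (Suc j) \<union> F)"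
      have hL: "?h \<subseteq> L j"
        using insert.prems decr by (intro span_minimal sub) auto
      have "common_eigenvector_mod U (span (insert x ?h))"
      proof (rule common_eigenvector_mod_extend[OF subspace_span _ U(1)])
        show "z ** x - x ** z \<in> ?h" if "z \<in> ?h" for z
          using bracket[of x j z] that hL insert.prems by (auto intro: span_base)
        show "z *v u \<in> U" if "z \<in> ?h" "u \<in> U" for z u
          using that hL L0 LU by blast
        show "x *v u \<in> U" if "u \<in> U" for u
          using that insert.prems L0 LU by blast
        show "common_eigenvector_mod U ?h"
          using insert by simp
      qed
      moreover have "span (L (Suc j) \<union> insert x F) \<subseteq> span (insert x ?h)"
        by (intro span_mono) (auto intro: span_base)
      ultimately show ?case
        by (rule common_eigenvector_mod_mono)
    qed
    obtain B where B: "B \<subseteq> L j" "independent B" "L j \<subseteq> span B"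
      using basis_exists[of "L j"] by metis
    have "common_eigenvector_mod U (span (L (Suc j) \<union> B))"
      using B by (intro fin independent_imp_finite)
    moreover have "L j \<subseteq> span (L (Suc j) \<union> B)"
      using B(3) span_mono[of B "L (Suc j) \<union> B"] by blast
    ultimately show ?case
      by (rule common_eigenvector_mod_mono)
  qed
  then show ?thesis by simp
qed

section \<open>From common eigenvectors to triangular form\<close>

text \<open>
  The basis vectors are indexed by the matrix indices themselves, so that the order of the type determines
  the flag. The definition refers to an initial segment \<open>A\<close>, because the flag is built upwards
  along the order.
\<close>

definition adapted_flag ::
    "(complex^'d::{finite,linorder}^'d::{finite,linorder}) set \<Rightarrow> 'd::{finite,linorder} set
      \<Rightarrow> ('d::{finite,linorder} \<Rightarrow> complex^'d::{finite,linorder}) \<Rightarrow> bool" where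
  "adapted_flag S A v \<longleftrightarrow>
     (\<forall>i\<in>A. v i \<notin> vec.span (v ` {j\<in>A. j < i})) \<and>
     (\<forall>i\<in>A. \<forall>y\<in>S. \<forall>u\<in>vec.span (v ` {j\<in>A. j \<le> i}). y *v u \<in> vec.span (v ` {j\<in>A. j \<le> i}))"

text \<open>
  The next vector \<open>u\<close> is a common eigenvector modulo the span \<open>?U\<close> of the previous
  ones, which is a proper subspace for dimension reasons.
\<close>

lemma exists_adapted_flag:
  fixes S :: "(complex^'d::{finite,linorder}^'d::{finite,linorder}) set"
  assumes ev: "\<And>U. vec.subspace U \<Longrightarrow> U \<noteq> UNIV \<Longrightarrow> (\<And>y u. y \<in> S \<Longrightarrow> u \<in> U \<Longrightarrow> y *v u \<in> U)
      \<Longrightarrow> common_eigenvector_mod U S"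
  shows "\<exists>v. adapted_flag S UNIV v"
proof -
  have "\<exists>v. adapted_flag S A v \<and> (\<forall>y\<in>S. \<forall>u\<in>vec.span (v ` A). y *v u \<in> vec.span (v ` A))"
    if "finite A" for A :: "'d set"
    using that
  proof (induction A rule: finite_linorder_max_induct)
    case empty
    show ?case by (simp add: adapted_flag_def)
  next
    case (insert b A)
    then obtain v where v: "adapted_flag S A v"
        and inv: "\<And>y u. y \<in> S \<Longrightarrow> u \<in> vec.span (v ` A) \<Longrightarrow> y *v u \<in> vec.span (v ` A)"
      by blast
    have bA: "b \<notin> A" using insert by blast
    let ?U = "vec.span (v ` A)"
    have "vec.dim ?U \<le> card (v ` A)"
      by (rule vec.dim_le_card) (auto simp: insert)
    also have "\<dots> \<le> card A" by (rule card_image_le) (rule insert)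
    also have "\<dots> < CARD('d)"
      using bA by (intro psubset_card_mono) auto
    finally have "?U \<noteq> UNIV"
      by (metis less_irrefl vec_dim_card)
    then obtain u where u: "u \<notin> ?U" and c: "\<And>y. y \<in> S \<Longrightarrow> \<exists>c. y *v u - c *s u \<in> ?U"
      using ev[OF vec.subspace_span _ inv] unfolding common_eigenvector_mod_def by blast
    define v' where "v' = v(b := u)"
    have v'_eq: "v' ` {j \<in> insert b A. P j} = v ` {j \<in> A. P j}" if "\<not> P b" for P
      using bA that by (auto simp: v'_def)
    have v'_all: "v' ` insert b A = insert u (v ` A)"
      using bA by (auto simp: v'_def)
    have inv': "y *v x \<in> vec.span (insert u (v ` A))"
      if y: "y \<in> S" and x: "x \<in> vec.span (insert u (v ` A))" for y x
    proof -
      obtain k where k: "x - k *s u \<in> ?U"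
        using x vec.span_breakdown_eq by blast
      obtain c where c: "y *v u - c *s u \<in> ?U"
        using c y by blast
      have "y *v x - (k * c) *s u = y *v (x - k *s u) + k *s (y *v u - c *s u)"
        by (simp add: matrix_vector_mult_diff_distrib vector_scalar_commute
            vec.scale_right_diff_distrib vector_smult_assoc)
      also have "\<dots> \<in> ?U"
        by (intro vec.span_add vec.span_scale inv y k c)
      finally show ?thesis
        using vec.span_breakdown_eq by blast
    qed
    have less: "{j \<in> insert b A. j < b} = A" and le: "{j \<in> insert b A. j \<le> b} = insert b A"
      using insert by auto
    have "adapted_flag S (insert b A) v'"
      unfolding adapted_flag_def
    proof (intro conjI ballI)
      fix i assume i: "i \<in> insert b A"
      show "v' i \<notin> vec.span (v' ` {j \<in> insert b A. j < i})"
      proof (cases "i = b")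
        case True
        have "v' ` A = v ` A" using bA by (auto simp: v'_def)
        with u show ?thesis unfolding True less by (simp add: v'_def)
      next
        case False
        with i insert have "\<not> b < i" "i \<in> A" by auto
        then show ?thesis
          using v False by (subst v'_eq) (auto simp: adapted_flag_def v'_def)
      qed
      fix y x assume y: "y \<in> S" and x: "x \<in> vec.span (v' ` {j \<in> insert b A. j \<le> i})"
      show "y *v x \<in> vec.span (v' ` {j \<in> insert b A. j \<le> i})"
      proof (cases "i = b")
        case True
        show ?thesis
          using x inv'[OF y] unfolding True le v'_all by blast
      next
        case False
        with i insert have "\<not> b \<le> i" "i \<in> A" by auto
        then show ?thesis
          using v x y unfolding v'_eq[of "\<lambda>j. j \<le> i", OF \<open>\<not> b \<le> i\<close>] adapted_flag_def by blast
      qed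
    qed
    moreover have "\<forall>y\<in>S. \<forall>u\<in>vec.span (v' ` insert b A). y *v u \<in> vec.span (v' ` insert b A)"
      unfolding v'_all using inv' by blast
    ultimately show ?case by blast
  qed
  from this[of UNIV] show ?thesis by auto
qed

lemma matrix_vector_mult_axis: "(A *v axis j 1) $ i = (A :: 'a::comm_semiring_1^'n^'m) $ i $ j"
  by (simp add: matrix_vector_mult_def axis_def if_distrib cong: if_cong)

text \<open>
  The matrix \<open>P\<close> has the columns \<open>v j\<close>. It is injective: in a nontrivial relation
  the vector of largest index would lie in the span of the earlier ones.
\<close>

lemma adapted_flag_triangularizes:
  fixes v :: "'d::{finite,linorder} \<Rightarrow> complex^'d::{finite,linorder}"
  assumes v: "\<And>i. v i \<notin> vec.span (v ` {..<i})"
  shows "\<exists>P P' :: complex^'d::{finite,linorder}^'d::{finite,linorder}. P ** P' = mat 1 \<and> P' ** P = mat 1 \<and>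
    (\<forall>A i j. j < i \<longrightarrow> A *v v j \<in> vec.span (v ` {..j}) \<longrightarrow> (P' ** A ** P) $ i $ j = 0)"
proof -
  define P :: "complex^'d::{finite,linorder}^'d::{finite,linorder}" where "P = (\<chi> i j. v j $ i)"
  have Px: "P *v x = (\<Sum>j\<in>UNIV. x $ j *s v j)" for x
    by (simp add: vec_eq_iff P_def matrix_vector_mult_def mult.commute)
  have Pe: "P *v axis j 1 = v j" for j
    by (simp add: P_def vec_eq_iff matrix_vector_mult_axis)
  have ker: "x = 0" if "P *v x = 0" for x
  proof (rule ccontr)
    assume "x \<noteq> 0"
    then have ne: "{i. x $ i \<noteq> 0} \<noteq> {}" by (auto simp: vec_eq_iff)
    define i where "i = Max {i. x $ i \<noteq> 0}"
    have xi: "x $ i \<noteq> 0"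
      using Max_in[OF _ ne] by (simp add: i_def)
    have above: "x $ j = 0" if "i < j" for j
      using Max_ge[of "{i. x $ i \<noteq> 0}" j] that unfolding i_def by fastforce
    have "(\<Sum>j\<in>UNIV. x $ j *s v j) = x $ i *s v i + (\<Sum>j\<in>UNIV - {i}. x $ j *s v j)"
      by (rule sum.remove) auto
    then have "x $ i *s v i = - (\<Sum>j\<in>UNIV - {i}. x $ j *s v j)"
      using that by (simp add: Px eq_neg_iff_add_eq_0)
    also have "\<dots> \<in> vec.span (v ` {..<i})"
    proof (intro vec.span_neg vec.span_sum)
      fix j assume j: "j \<in> UNIV - {i}"
      show "x $ j *s v j \<in> vec.span (v ` {..<i})"
      proof (cases "j < i")
        case True
        then show ?thesis by (intro vec.span_scale vec.span_base) auto
      next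
        case False
        then show ?thesis using above[of j] j by (simp add: vec.span_zero)
      qed
    qed
    finally have "inverse (x $ i) *s (x $ i *s v i) \<in> vec.span (v ` {..<i})"
      by (rule vec.span_scale)
    moreover have "inverse (x $ i) *s (x $ i *s v i) = v i"
      using xi unfolding vector_smult_assoc by simp
    ultimately show False using v by simp
  qed
  have "inj ((*v) P)"
  proof (rule injI)
    fix x y assume "P *v x = P *v y"
    then have "P *v (x - y) = 0" by (simp add: matrix_vector_mult_diff_distrib)
    from ker[OF this] show "x = y" by simp
  qed
  then obtain P' where P'P: "P' ** P = mat 1"
    using matrix_left_invertible_injective by blast
  then have PP': "P ** P' = mat 1"
    by (simp add: matrix_left_right_inverse)
  have tri: "(P' ** A ** P) $ i $ j = 0" if ij: "j < i" and A: "A *v v j \<in> vec.span (v ` {..j})" for A i j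
  proof -
    let ?T = "{u. \<forall>k>j. (P' *v u) $ k = 0}"
    have "vec.subspace ?T"
      by (auto simp: vec.subspace_def matrix_vector_right_distrib vector_scalar_commute)
    moreover have "v ` {..j} \<subseteq> ?T"
    proof clarsimp
      fix l k assume "l \<le> j" "j < k"
      moreover have "P' *v v l = axis l 1"
        unfolding Pe[symmetric] matrix_vector_mul_assoc P'P by simp
      ultimately show "(P' *v v l) $ k = 0" by (simp add: axis_def)
    qed
    ultimately have "vec.span (v ` {..j}) \<subseteq> ?T"
      by (intro vec.span_minimal)
    with A ij have "(P' *v (A *v v j)) $ i = 0" by blast
    also have "P' *v (A *v v j) = (P' ** A ** P) *v axis j 1"
      by (simp add: Pe flip: matrix_vector_mul_assoc)
    also have "\<dots> $ i = (P' ** A ** P) $ i $ j"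
      by (rule matrix_vector_mult_axis)
    finally show ?thesis .
  qed
  show ?thesis
    using P'P PP' tri by blast
qed

section \<open>The algebra of pairs of a real and a complex matrix\<close>

interpretation rmat: fin_dim_algebra "(**) :: real^'n^'n \<Rightarrow> real^'n^'n \<Rightarrow> real^'n^'n" "mat 1"
  by (rule fin_dim_algebra_matrix)

lemma Lie_algebra_eq: "Lie_algebra G = rmat.Lie G"
  by (simp add: Lie_algebra_def rmat.Lie_def matrix_exp_def rmat.Exp_def)

definition pair_mult ::
    "(real^'n^'n) \<times> (complex^'d^'d) \<Rightarrow> (real^'n^'n) \<times> (complex^'d^'d) \<Rightarrow> (real^'n^'n) \<times> (complex^'d^'d)" where
  "pair_mult x y = (fst x ** fst y, snd x ** snd y)"

lemma fin_dim_algebra_pair: "fin_dim_algebra pair_mult (mat 1, mat 1)"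
proof
  have "linear (\<lambda>y. pair_mult x y)" "linear (\<lambda>y. pair_mult y x)" for x :: "(real^'n^'n) \<times> (complex^'d^'d)"
    by (rule linearI; simp add: pair_mult_def prod_eq_iff rmat.mult.add_left rmat.mult.add_right
        cmat.mult.add_left cmat.mult.add_right rmat.mult.scaleR_left rmat.mult.scaleR_right
        cmat.mult.scaleR_left cmat.mult.scaleR_right)+
  then show "bilinear (pair_mult :: (real^'n^'n) \<times> (complex^'d^'d) \<Rightarrow> _)"
    unfolding bilinear_def by blast
qed (simp_all add: pair_mult_def matrix_mul_assoc)

interpretation pair: fin_dim_algebra
  "pair_mult :: (real^'n^'n) \<times> (complex^'d^'d) \<Rightarrow> (real^'n^'n) \<times> (complex^'d^'d) \<Rightarrow> (real^'n^'n) \<times> (complex^'d^'d)"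
  "(mat 1, mat 1)"
  by (rule fin_dim_algebra_pair)

lemma pair_Exp: "pair.Exp (X, Y) = (rmat.Exp X, cmat.Exp Y)"
proof -
  have pow: "(pair_mult (X, Y) ^^ k) (mat 1, mat 1) = (((**) X ^^ k) (mat 1), ((**) Y ^^ k) (mat 1))" for k
    by (induction k) (simp_all add: pair_mult_def)
  have "fst (pair.Exp (X, Y)) = rmat.Exp X"
    using bounded_linear.sums[OF bounded_linear_fst pair.Exp_sums[of "(X, Y)"]] rmat.Exp_sums[of X]
    by (simp add: pow) (rule sums_unique2)
  moreover have "snd (pair.Exp (X, Y)) = cmat.Exp Y"
    using bounded_linear.sums[OF bounded_linear_snd pair.Exp_sums[of "(X, Y)"]] cmat.Exp_sums[of Y]
    by (simp add: pow) (rule sums_unique2)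
  ultimately show ?thesis by (simp add: prod_eq_iff)
qed

section \<open>Representations of solvable groups\<close>

lemma derived_series_Suc: "derived_series (Suc j) L = derived (derived_series j L)"
  by (simp add: derived_series_def)

lemma bracket_in_derived: "x \<in> L \<Longrightarrow> y \<in> L \<Longrightarrow> bracket x y \<in> derived L"
  unfolding derived_def by (rule span_base) blast

lemma derived_series_decreasing:
  assumes "subspace L" and "\<And>x y. x \<in> L \<Longrightarrow> y \<in> L \<Longrightarrow> bracket x y \<in> L"
  shows "subspace (derived_series j L) \<and> derived_series (Suc j) L \<subseteq> derived_series j L"
proof (induction j)
  case 0
  have "derived L \<subseteq> L"
    unfolding derived_def by (rule span_minimal) (use assms in auto)
  then show ?case
    using assms(1) by (simp add: derived_series_def)
next
  case (Suc j)
  have "derived (derived_series (Suc j) L) \<subseteq> derived (derived_series j L)"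
    using Suc unfolding derived_def by (intro span_mono) blast
  then show ?case
    unfolding derived_series_Suc by (simp add: derived_def)
qed

text \<open>An injective linear map that sends \<open>U\<close> into itself sends it onto itself, by dimension.\<close>

lemma inverse_preserves_subspace:
  fixes A B :: "complex^'d^'d"
  assumes U: "vec.subspace U" and AU: "\<And>u. u \<in> U \<Longrightarrow> A *v u \<in> U" and BA: "B ** A = mat 1" and u: "u \<in> U"
  shows "B *v u \<in> U"
proof -
  have BAu: "B *v (A *v x) = x" for x
    by (simp add: matrix_vector_mul_assoc BA)
  have inj: "inj_on ((*v) A) (span U)"
    by (metis BAu inj_on_inverseI)
  have sU: "subspace U"
    using U by (rule complex_subspace_imp_subspace)
  have lin: "linear ((*v) A)"
    by (rule matrix_vector_mul_linear)
  have "(*v) A ` U = U"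
  proof (rule subspace_dim_equal)
    show "subspace ((*v) A ` U)"
      by (rule linear_subspace_image[OF lin sU])
    show "dim U \<le> dim ((*v) A ` U)"
      using dim_image_eq[OF lin inj] by simp
  qed (use sU AU in auto)
  with u obtain w where "w \<in> U" "u = A *v w" by blast
  then show ?thesis by (simp add: BAu)
qed

lemma closed_group_of_matrix_Lie_group:
  fixes G :: "(real^'n^'n) set"
  assumes "matrix_Lie_group G"
  shows "rmat.closed_group G"
  unfolding rmat.closed_group_def
proof (intro conjI ballI allI impI)
  have sub: "subgroup G GL" and clo: "closedin (top_of_set (carrier GL)) G"
    using assms by (auto simp: matrix_Lie_group_def)
  note GL = group_GL[where 'a = real and 'n = 'n]
  show "mat 1 \<in> G"
    using subgroup.one_closed[OF sub] by (simp add: GL_def)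
  show "x ** y \<in> G" if "x \<in> G" "y \<in> G" for x y
    using subgroup.m_closed[OF sub that] by (simp add: GL_def)
  show "\<exists>y\<in>G. x ** y = mat 1 \<and> y ** x = mat 1" if "x \<in> G" for x
    using subgroup.m_inv_closed[OF sub that] group.r_inv[OF GL] group.l_inv[OF GL]
      subgroup.mem_carrier[OF sub that] by (intro bexI[of _ "inv\<^bsub>GL\<^esub> x"]) (simp_all add: GL_def)
  fix X x y assume X: "\<forall>k. X k \<in> G" "X \<longlonglongrightarrow> x" and "x ** y = mat 1" "y ** x = mat 1"
  then have "x \<in> carrier GL"
    by (auto simp: GL_def invertible_def)
  moreover obtain T where "closed T" "G = carrier GL \<inter> T"
    using clo by (auto simp: closedin_closed)
  ultimately show "x \<in> G"
    using closed_sequentially[of T X x] X by auto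
qed

locale solvable_representation =
  fixes G :: "(real^'n^'n) set"
    and \<rho> :: "real^'n^'n \<Rightarrow> complex^'d::{finite,linorder}^'d::{finite,linorder}"
  assumes solvable: "solvable_Lie_group G"
    and rep: "representation G \<rho>"
begin

lemma group_G: "rmat.closed_group G"
  using solvable closed_group_of_matrix_Lie_group by (auto simp: solvable_Lie_group_def)

lemma rho_mult: "x \<in> G \<Longrightarrow> y \<in> G \<Longrightarrow> \<rho> (x ** y) = \<rho> x ** \<rho> y"
  using rep by (auto simp: representation_def hom_def GL_def)

lemma rho_GL: "x \<in> G \<Longrightarrow> \<rho> x \<in> carrier GL"
  using rep by (auto simp: representation_def hom_def)

lemma rho_one: "\<rho> (mat 1) = mat 1"
proof -
  have one: "mat 1 \<in> G" by (rule rmat.closed_groupD(1)[OF group_G])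
  obtain B where B: "B ** \<rho> (mat 1) = mat 1"
    using rho_GL[OF one] by (auto simp: GL_def invertible_def)
  have "B ** (\<rho> (mat 1) ** \<rho> (mat 1)) = B ** \<rho> (mat 1)"
    using rho_mult[OF one one] by simp
  then show ?thesis
    by (simp add: matrix_mul_assoc B)
qed

definition graph :: "((real^'n^'n) \<times> (complex^'d::{finite,linorder}^'d::{finite,linorder})) set" where
  "graph = (\<lambda>g. (g, \<rho> g)) ` G"

lemma graph_iff: "(x, y) \<in> graph \<longleftrightarrow> x \<in> G \<and> y = \<rho> x"
  by (auto simp: graph_def)

text \<open>If \<open>(g, \<rho> g)\<close> tends to a unit, then \<open>g\<close> converges inside \<open>G\<close>, and continuity of \<open>\<rho>\<close> gives the limit.\<close>

lemma closed_group_graph: "pair.closed_group graph"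
  unfolding pair.closed_group_def
proof (intro conjI ballI allI impI)
  show "(mat 1, mat 1) \<in> graph"
    by (simp add: graph_iff rho_one rmat.closed_groupD(1)[OF group_G])
  show "pair_mult x y \<in> graph" if "x \<in> graph" "y \<in> graph" for x y
    using that rmat.closed_groupD(2)[OF group_G]
    by (auto simp: graph_def pair_mult_def rho_mult)
  show "\<exists>y\<in>graph. pair_mult x y = (mat 1, mat 1) \<and> pair_mult y x = (mat 1, mat 1)"
    if "x \<in> graph" for x
  proof -
    obtain g where g: "g \<in> G" "x = (g, \<rho> g)" using \<open>x \<in> graph\<close> by (auto simp: graph_def)
    obtain g' where g': "g' \<in> G" "g ** g' = mat 1" "g' ** g = mat 1"
      using rmat.closed_groupD(3)[OF group_G g(1)] by blast
    have "\<rho> g ** \<rho> g' = mat 1" "\<rho> g' ** \<rho> g = mat 1"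
      using g g' rho_mult rho_one by metis+
    then show ?thesis
      using g g' by (intro bexI[of _ "(g', \<rho> g')"]) (auto simp: pair_mult_def graph_iff)
  qed
  fix X x y assume X: "\<forall>k. X k \<in> graph" "X \<longlonglongrightarrow> x"
    and inv: "pair_mult x y = (mat 1, mat 1)" "pair_mult y x = (mat 1, mat 1)"
  have Xk: "fst (X k) \<in> G" "snd (X k) = \<rho> (fst (X k))" for k
    using X(1)[rule_format, of k] by (auto simp: graph_def)
  have lim: "(\<lambda>k. fst (X k)) \<longlonglongrightarrow> fst x"
    by (rule tendsto_fst[OF X(2)])
  have x: "fst x \<in> G"
    by (rule rmat.closed_groupD(5)[OF group_G Xk(1) lim, of "fst y"])
      (use inv in \<open>simp_all add: pair_mult_def\<close>)
  have "continuous_on G \<rho>"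
    using rep by (simp add: representation_def)
  then have "(\<lambda>k. \<rho> (fst (X k))) \<longlonglongrightarrow> \<rho> (fst x)"
    using continuous_on_tendsto_compose[OF _ lim x] Xk(1) by simp
  moreover have "(\<lambda>k. \<rho> (fst (X k))) \<longlonglongrightarrow> snd x"
    using tendsto_snd[OF X(2)] by (simp add: Xk(2))
  ultimately have "snd x = \<rho> (fst x)"
    by (rule LIMSEQ_unique[symmetric])
  with x have "(fst x, snd x) \<in> graph"
    unfolding graph_iff by simp
  then show "x \<in> graph"
    by (simp only: prod.collapse)
qed

lemma connected_graph: "connected graph"
  unfolding graph_def
proof (rule connected_continuous_image)
  show "continuous_on G (\<lambda>g. (g, \<rho> g))"
    using rep by (intro continuous_on_Pair continuous_on_id) (simp add: representation_def)
  show "connected G"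
    using solvable by (simp add: solvable_Lie_group_def)
qed

lemma Lie_graph_iff:
  "(X, Y) \<in> pair.Lie graph \<longleftrightarrow>
     (\<forall>t. rmat.Exp (t *\<^sub>R X) \<in> G \<and> cmat.Exp (t *\<^sub>R Y) = \<rho> (rmat.Exp (t *\<^sub>R X)))"
  by (simp add: pair.Lie_def pair_Exp graph_iff)

text \<open>The images of the derived series under the differential of \<open>\<rho>\<close>, read off from the graph.\<close>

definition image_series :: "nat \<Rightarrow> (complex^'d::{finite,linorder}^'d::{finite,linorder}) set" where
  "image_series j = {Y. \<exists>X \<in> derived_series j (Lie_algebra G). (X, Y) \<in> pair.Lie graph}"

lemma image_series_0: "(X, Y) \<in> pair.Lie graph \<Longrightarrow> Y \<in> image_series 0"
  by (auto simp: image_series_def derived_series_def Lie_algebra_eq rmat.Lie_def Lie_graph_iff)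

text \<open>
  The chain \<open>image_series\<close> ends in 0 because a pair \<open>(0, Y)\<close> in the Lie algebra of
  the graph has \<open>Y = 0\<close>.
\<close>

lemma common_eigenvector:
  assumes U: "vec.subspace U" "U \<noteq> UNIV" and inv_U: "\<And>y u. y \<in> image_series 0 \<Longrightarrow> u \<in> U \<Longrightarrow> y *v u \<in> U"
  shows "common_eigenvector_mod U (image_series 0)"
proof -
  have subG: "subspace (Lie_algebra G)"
    unfolding Lie_algebra_eq by (rule rmat.subspace_Lie[OF group_G])
  have "bracket x y \<in> Lie_algebra G" if "x \<in> Lie_algebra G" "y \<in> Lie_algebra G" for x y
    using rmat.Lie_bracket[OF group_G, of y x] that by (simp add: bracket_def Lie_algebra_eq)
  note D = derived_series_decreasing[OF subG this]
  have sub: "subspace (pair.Lie graph)"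
    by (rule pair.subspace_Lie[OF closed_group_graph])
  obtain k where k: "derived_series k (Lie_algebra G) = {0}"
    using solvable by (auto simp: solvable_Lie_group_def)
  show ?thesis
  proof (rule solvable_common_eigenvector_mod[OF _ _ _ _ U inv_U])
    show "subspace (image_series j)" for j
    proof (rule subspaceI)
      have Dj: "subspace (derived_series j (Lie_algebra G))"
        using D by blast
      show "0 \<in> image_series j"
        using subspace_0[OF sub] subspace_0[OF Dj] by (auto simp: image_series_def zero_prod_def)
      show "x + y \<in> image_series j" if xy: "x \<in> image_series j" "y \<in> image_series j" for x y
      proof -
        obtain X Y where "X \<in> derived_series j (Lie_algebra G)" "(X, x) \<in> pair.Lie graph"
          "Y \<in> derived_series j (Lie_algebra G)" "(Y, y) \<in> pair.Lie graph"
          using xy by (auto simp: image_series_def)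
        then have "X + Y \<in> derived_series j (Lie_algebra G)" "(X, x) + (Y, y) \<in> pair.Lie graph"
          using subspace_add[OF Dj] subspace_add[OF sub] by blast+
        then show ?thesis by (auto simp: image_series_def)
      qed
      show "c *\<^sub>R x \<in> image_series j" if x: "x \<in> image_series j" for c x
      proof -
        obtain X where "X \<in> derived_series j (Lie_algebra G)" "(X, x) \<in> pair.Lie graph"
          using x by (auto simp: image_series_def)
        then have "c *\<^sub>R X \<in> derived_series j (Lie_algebra G)" "c *\<^sub>R (X, x) \<in> pair.Lie graph"
          using subspace_scale[OF Dj] subspace_scale[OF sub] by blast+
        then show ?thesis by (auto simp: image_series_def)
      qed
    qed
    show "image_series (Suc j) \<subseteq> image_series j" for j
      using D by (auto simp: image_series_def)
    show "y ** x - x ** y \<in> image_series (Suc j)" if "x \<in> image_series j" "y \<in> image_series j" for j x y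
    proof -
      obtain X Y where X: "X \<in> derived_series j (Lie_algebra G)" "(X, x) \<in> pair.Lie graph"
        and Y: "Y \<in> derived_series j (Lie_algebra G)" "(Y, y) \<in> pair.Lie graph"
        using \<open>x \<in> image_series j\<close> \<open>y \<in> image_series j\<close> by (auto simp: image_series_def)
      have "(Y ** X - X ** Y, y ** x - x ** y) \<in> pair.Lie graph"
        using pair.Lie_bracket[OF closed_group_graph X(2) Y(2)] by (simp add: pair_mult_def)
      moreover have "Y ** X - X ** Y \<in> derived_series (Suc j) (Lie_algebra G)"
        using bracket_in_derived[OF Y(1) X(1)] by (simp add: derived_series_Suc bracket_def)
      ultimately show ?thesis by (auto simp: image_series_def)
    qed
    show "image_series k \<subseteq> {0}"
    proof
      fix Y assume "Y \<in> image_series k"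
      then have "(0, Y) \<in> pair.Lie graph" by (simp add: image_series_def k)
      then have "cmat.Exp (t *\<^sub>R Y) = mat 1" for t
        by (simp add: Lie_graph_iff rho_one)
      then show "Y \<in> {0}" using cmat.eq_0_if_Exp_trivial by blast
    qed
  qed
qed

text \<open>
  The stabiliser \<open>H\<close> of \<open>U\<close> in the graph contains all \<open>Exp (t *\<^sub>R (X,
  Y))\<close> with \<open>(X, Y)\<close> in the Lie algebra of the graph, since the corresponding
  \<open>Y\<close> preserve \<open>U\<close>; so \<open>H\<close> is the whole graph.
\<close>

lemma invariant_under_rho:
  assumes U: "vec.subspace U" and inv_U: "\<And>y u. y \<in> image_series 0 \<Longrightarrow> u \<in> U \<Longrightarrow> y *v u \<in> U"
    and g: "g \<in> G" and u: "u \<in> U"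
  shows "\<rho> g *v u \<in> U"
proof -
  define H where "H = {x \<in> graph. \<forall>u\<in>U. snd x *v u \<in> U}"
  have "pair.closed_group H"
    unfolding pair.closed_group_def
  proof (intro conjI ballI allI impI)
    show "(mat 1, mat 1) \<in> H"
      using pair.closed_groupD(1)[OF closed_group_graph] by (simp add: H_def)
    show "pair_mult x y \<in> H" if "x \<in> H" "y \<in> H" for x y
      using that pair.closed_groupD(2)[OF closed_group_graph, of x y]
      by (auto simp: H_def pair_mult_def simp flip: matrix_vector_mul_assoc)
    show "\<exists>y\<in>H. pair_mult x y = (mat 1, mat 1) \<and> pair_mult y x = (mat 1, mat 1)"
      if x: "x \<in> H" for x
    proof -
      obtain y where y: "y \<in> graph" "pair_mult x y = (mat 1, mat 1)" "pair_mult y x = (mat 1, mat 1)"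
        using pair.closed_groupD(3)[OF closed_group_graph, of x] x by (auto simp: H_def)
      have "snd y *v u \<in> U" if "u \<in> U" for u
        by (rule inverse_preserves_subspace[OF U _ _ that, of "snd x"])
          (use x y in \<open>auto simp: H_def pair_mult_def\<close>)
      with y show ?thesis by (intro bexI[of _ y]) (simp_all add: H_def)
    qed
    fix X x y assume X: "\<forall>k. X k \<in> H" "X \<longlonglongrightarrow> x"
      and inv: "pair_mult x y = (mat 1, mat 1)" "pair_mult y x = (mat 1, mat 1)"
    have "x \<in> graph"
      by (rule pair.closed_groupD(5)[OF closed_group_graph _ X(2) inv])
        (use X(1) in \<open>auto simp: H_def\<close>)
    moreover have "snd x *v u \<in> U" if "u \<in> U" for u
    proof (rule closed_sequentially[OF closed_subspace[OF complex_subspace_imp_subspace[OF U]]])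
      show "snd (X k) *v u \<in> U" for k
        using X(1) that by (auto simp: H_def)
      show "(\<lambda>k. snd (X k) *v u) \<longlonglongrightarrow> snd x *v u"
        by (rule bounded_linear.tendsto[OF bounded_linear_matrix_apply tendsto_snd[OF X(2)]])
    qed
    ultimately show "x \<in> H" by (simp add: H_def)
  qed
  moreover have "pair.Lie graph \<subseteq> pair.Lie H"
  proof clarify
    fix X Y assume XY: "(X, Y) \<in> pair.Lie graph"
    then have "cmat.Exp (t *\<^sub>R Y) *v u \<in> U" if "u \<in> U" for t u
      by (intro cmat_Exp_invariant[OF U inv_U that] image_series_0)
    with XY show "(X, Y) \<in> pair.Lie H"
      by (simp add: pair.Lie_def H_def pair_Exp)
  qed
  ultimately have "H = graph"
    using connected_graph by (intro pair.closed_subgroup_eq[OF closed_group_graph]) (auto simp: H_def)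
  then have "(g, \<rho> g) \<in> H"
    using g by (simp add: graph_iff)
  with u show ?thesis by (simp add: H_def)
qed

end

theorem theorem3p2:
  fixes G :: "(real^'n^'n) set"
    and \<rho> :: "real^'n^'n \<Rightarrow> complex^'d::{finite,linorder}^'d::{finite,linorder}"
  assumes "solvable_Lie_group G"
    and "representation G \<rho>"
  shows "\<exists>g \<in> carrier GL.
           (\<lambda>x. g \<otimes>\<^bsub>GL\<^esub> \<rho> x \<otimes>\<^bsub>GL\<^esub> inv\<^bsub>GL\<^esub> g) ` G \<subseteq> upper_triangular_group"
proof -
  interpret solvable_representation G \<rho>
    by (rule solvable_representation.intro) fact+
  note GL = group_GL[where 'a = complex and 'n = 'd]
  obtain v where v: "adapted_flag (image_series 0) UNIV v"
    using exists_adapted_flag[OF common_eigenvector] by blast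
  then have "v i \<notin> vec.span (v ` {..<i})" for i
    by (simp add: adapted_flag_def lessThan_def)
  from adapted_flag_triangularizes[OF this] obtain P P' :: "complex^'d::{finite,linorder}^'d::{finite,linorder}"
    where P: "P ** P' = mat 1" "P' ** P = mat 1"
      and tri: "\<And>A i j. j < i \<Longrightarrow> A *v v j \<in> vec.span (v ` {..j}) \<Longrightarrow> (P' ** A ** P) $ i $ j = 0"
    by blast
  have mem: "\<rho> x *v v j \<in> vec.span (v ` {..j})" if "x \<in> G" for x j
  proof (rule invariant_under_rho[OF vec.subspace_span _ that])
    show "y *v u \<in> vec.span (v ` {..j})" if "y \<in> image_series 0" "u \<in> vec.span (v ` {..j})" for y u
      using v that by (simp add: adapted_flag_def atMost_def)
    show "v j \<in> vec.span (v ` {..j})"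
      by (rule vec.span_base) simp
  qed
  have carrier: "P' \<in> carrier GL" "P \<in> carrier GL"
    using P by (auto simp: GL_def invertible_def)
  have inv: "inv\<^bsub>GL\<^esub> P' = P"
    by (rule group.inv_equality[OF GL _ carrier]) (simp add: GL_def P)
  have "P' \<otimes>\<^bsub>GL\<^esub> \<rho> x \<otimes>\<^bsub>GL\<^esub> inv\<^bsub>GL\<^esub> P' \<in> upper_triangular_group" if x: "x \<in> G" for x
  proof -
    have "P' \<otimes>\<^bsub>GL\<^esub> \<rho> x \<otimes>\<^bsub>GL\<^esub> P \<in> carrier GL"
      using carrier rho_GL[OF x] GL by (simp add: group.is_monoid monoid.m_closed)
    moreover have "P' \<otimes>\<^bsub>GL\<^esub> \<rho> x \<otimes>\<^bsub>GL\<^esub> P = P' ** \<rho> x ** P"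
      by (simp add: GL_def)
    ultimately show ?thesis
      unfolding inv upper_triangular_group_def using tri mem[OF x] by simp
  qed
  with carrier show ?thesis by blast
qed

end
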